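(* Suppose $p(a,x)\in\mathbb R\langle a,x\rangle$ is a symmetric polynomial of degree $d_a$ in $a$ and degree $d_x\ge 2$ in $x$, and $\mathcal W\subset\mathbb S(\mathbb R^g\times\mathbb R^g)$ is a domain. If (i) $\mathcal W$ is open in $a$; and (ii) for each $n$, each $(A,X)\in\mathcal W_n$ and every $H\in\mathbb S_n(\mathbb R^g)$, $\frac{\partial^2}{\partial x^2}p(A,X)[H]\succeq 0$, then either (A) there is a nonzero polynomial $q\in\mathbb R\langle a,x\rangle$ (not necessarily symmetric) of degree at most $d_a$ in $a$ and at most $d_x-2$ in $x$ such that $q(A,X)=0$ for all $(A,X)\in\mathcal W$; or (B) $p$ has degree at most two in $x$, and for each $n$ and each $A\in\pi_a(\mathcal W_n)$ the function $X\mapsto p(A,X)$ is (globally) convex in $X\in\mathbb S_n(\mathbb R^g)$. In particular, if $\mathcal W$ is open in $a$, $\frac{\partial^2}{\partial x^2}p(A,X)[H]\succeq 0$ for each $n$, each $(A,X)\in\mathcal W_n$ and every $H\in\mathbb S_n(\mathbb R^g)$, and in addition $\mathcal W$ is the product $\mathcal W=\mathbb S(\mathbb R^g)\times\mathcal V$ for some matrix convex $\mathcal V=(\mathcal V_n)_n$ in $\mathbb S(\mathbb R^g)$, then either (A$'$) there is a nonzero polynomial $q$ of degree at most $d_a$ in $a$ and at most $d_x-2$ in $x$ such that $q(A,X)=0$ for all $(A,X)\in\mathcal W$; or (B$'$) there exist a column vector of polynomials $\Lambda(a,x)$, linear (homogeneous of degree one) in $x$, and a polynomial $L(a,x)$ of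 degree at most one in $x$ such that $$p(a,x)=L(a,x)+\Lambda(a,x)^T\Lambda(a,x).$$
   Context: Fix a positive integer $g$. $\mathbb R\langle a,x\rangle$ denotes the polynomials with real coefficients in the non-commuting variables $a=(a_1,\dots,a_g)$, $x=(x_1,\dots,x_g)$. The involution ${}^T$ on $\mathbb R\langle a,x\rangle$ is linear, reverses the order of words, and fixes each variable; $p$ is symmetric if $p^T=p$. For a column vector $\Lambda$ of polynomials $\Lambda_j$, $\Lambda^T\Lambda=\sum_j\Lambda_j^T\Lambda_j$. $\mathbb S_n(\mathbb R^g)$ is the set of $g$-tuples of real symmetric $n\times n$ matrices, $\mathbb S_n(\mathbb R^g\times\mathbb R^g)$ is the set of pairs $(A,X)$ with $A,X\in\mathbb S_n(\mathbb R^g)$; polynomials are evaluated at such tuples by substitution. $P\succeq0$ means $P$ is symmetric positive semidefinite. $\mathbb S(\mathbb R^g)=(\mathbb S_n(\mathbb R^g))_n$ and $\mathbb S(\mathbb R^g\times\mathbb R^g)=(\mathbb S_n(\mathbb R^g\times\mathbb R^g))_n$. A domain $\mathcal D=(\mathcal D_n)_n$ in one of these is a sequence of subsets of the levels closed under direct sums: $D_1\in\mathcal D_{n_1}$ and $D_2\in\mathcal D_{n_2}$ imply $D_1\oplus D_2\in\mathcal D_{n_1+n_2}$. A domain $\mathcal V$ in $\mathbb S(\mathbb R^g)$ is matrix convex if for every isometry $V:\mathbb R^{n_1}\to\mathbb R^{n_2}$ and $D=(X_1,\dots,X_g)\in\mathcal V_{n_2}$, $V^TDV=(V^TX_1V,\dots,V^TX_gV)\in\mathcal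 V_{n_1}$. Products are taken levelwise. A domain $\mathcal W$ in $\mathbb S(\mathbb R^g\times\mathbb R^g)$ is open in $a$ if for each $n$ and $(A,X)\in\mathcal W_n$ there is an open subset $U$ of $\mathbb S_n(\mathbb R^g)$ containing $A$ with $U\times\{X\}\subset\mathcal W_n$. $\pi_a(\mathcal W_n)=\{A\in\mathbb S_n(\mathbb R^g):\exists X\in\mathbb S_n(\mathbb R^g),\ (A,X)\in\mathcal W_n\}$. The function $X\mapsto p(A,X)$ is globally convex if $tp(A,X)+(1-t)p(A,Y)-p(A,tX+(1-t)Y)\succeq0$ for all $X,Y\in\mathbb S_n(\mathbb R^g)$ and $0<t<1$. The partial Hessian $\frac{\partial^2}{\partial x^2}p(a,x)[h]$ of $p$ with respect to $x$ in the direction $h=(h_1,\dots,h_g)$ (additional non-commuting symmetric variables) is the formal second derivative at $t=0$ of $t\mapsto p(a,x+th)$; it is a polynomial in $(a,x,h)$, and $\frac{\partial^2}{\partial x^2}p(A,X)[H]$ is its evaluation at $(A,X,H)$. *)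

theory Defs
  imports
    "HOL-Library.Poly_Mapping"
    "HOL-Computational_Algebra.Polynomial"
    "Jordan_Normal_Form.Matrix"
begin

text \<open>
  The index type \<open>'g\<close>, of class \<open>finite\<close>, plays the role of the index set
  \<open>{1, \<dots>, g}\<close>.
\<close>

text \<open>
  With words as a monoid under concatenation, the convolution product of
  \<open>HOL-Library.Poly_Mapping\<close> makes \<open>'v list \<Rightarrow>\<^sub>0 'c\<close> the free algebra over \<open>'c\<close>
  in the non-commuting variables \<open>'v\<close>.
\<close>

instantiation list :: (type) monoid_add
begin

definition zero_list :: "'a list" where "zero_list = []"

definition plus_list :: "'a list \<Rightarrow> 'a list \<Rightarrow> 'a list" where "plus_list u v = u @ v"

instance
  by standard (simp_all add: zero_list_def plus_list_def)

end

type_synonym 'v ncpoly = "'v list \<Rightarrow>\<^sub>0 real"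

datatype 'g axvar = is_Avar: Avar 'g | is_Xvar: Xvar 'g

datatype 'g axhvar = AXvar "'g axvar" | Hvar 'g

definition nc_transpose :: "'v ncpoly \<Rightarrow> 'v ncpoly" where
  "nc_transpose p = Poly_Mapping.map_key rev p"

definition nc_symmetric :: "'v ncpoly \<Rightarrow> bool" where
  "nc_symmetric p \<longleftrightarrow> nc_transpose p = p"

text \<open>Degree in the variables satisfying \<open>P\<close>; the zero polynomial gets degree 0.\<close>

definition degree_in :: "('v \<Rightarrow> bool) \<Rightarrow> 'v ncpoly \<Rightarrow> nat" where
  "degree_in P p = Max (insert 0 ((\<lambda>w. length (filter P w)) ` Poly_Mapping.keys p))"

abbreviation degree_a :: "'g axvar ncpoly \<Rightarrow> nat" where
  "degree_a \<equiv> degree_in is_Avar"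

abbreviation degree_x :: "'g axvar ncpoly \<Rightarrow> nat" where
  "degree_x \<equiv> degree_in is_Xvar"

definition linear_in_x :: "'g axvar ncpoly \<Rightarrow> bool" where
  "linear_in_x p \<longleftrightarrow> (\<forall>w\<in>Poly_Mapping.keys p. length (filter is_Xvar w) = 1)"

text \<open>\<open>\<Lambda>\<^sup>T \<Lambda>\<close> for the column vector \<open>\<Lambda>\<close> whose entries are listed in \<open>\<Lambda>\<close>.\<close>

definition column_square :: "'v ncpoly list \<Rightarrow> 'v ncpoly" where
  "column_square \<Lambda> = (\<Sum>f\<leftarrow>\<Lambda>. nc_transpose f * f)"

text \<open>
  \<open>shift_x p\<close> is \<open>p(a, x + th)\<close>, an element of the free algebra in \<open>a, x, h\<close> over
  the commutative coefficient ring \<open>real poly\<close> of polynomials in \<open>t\<close> (so \<open>[:0, 1:]\<close> is \<open>t\<close>).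
  The partial Hessian differentiates its coefficients twice and sets \<open>t = 0\<close>.
\<close>

fun shift_var :: "'g axvar \<Rightarrow> ('g axhvar list \<Rightarrow>\<^sub>0 real poly)" where
  "shift_var (Avar j) = Poly_Mapping.single [AXvar (Avar j)] 1"
| "shift_var (Xvar j) =
     Poly_Mapping.single [AXvar (Xvar j)] 1 + Poly_Mapping.single [Hvar j] [:0, 1:]"

definition shift_x :: "'g axvar ncpoly \<Rightarrow> ('g axhvar list \<Rightarrow>\<^sub>0 real poly)" where
  "shift_x p = (\<Sum>w\<in>Poly_Mapping.keys p.
     Poly_Mapping.single [] [:Poly_Mapping.lookup p w:] * prod_list (map shift_var w))"

definition hessian_x :: "'g axvar ncpoly \<Rightarrow> 'g axhvar ncpoly" where
  "hessian_x p = Poly_Mapping.map (\<lambda>c. poly (pderiv (pderiv c)) 0) (shift_x p)"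

type_synonym 'g mtuple = "'g \<Rightarrow> real mat"

definition sym_tuples :: "nat \<Rightarrow> 'g mtuple set" where
  "sym_tuples n = {X. \<forall>j. X j \<in> carrier_mat n n \<and> transpose_mat (X j) = X j}"

definition psd :: "nat \<Rightarrow> real mat \<Rightarrow> bool" where
  "psd n P \<longleftrightarrow> P \<in> carrier_mat n n \<and> transpose_mat P = P \<and>
     (\<forall>v\<in>carrier_vec n. 0 \<le> v \<bullet> (P *\<^sub>v v))"

definition eval_word :: "nat \<Rightarrow> ('v \<Rightarrow> real mat) \<Rightarrow> 'v list \<Rightarrow> real mat" where
  "eval_word n \<sigma> w = foldr (\<lambda>v M. \<sigma> v * M) w (1\<^sub>m n)"

text \<open>The linear combination of the values of the words, written entrywise.\<close>

definition nc_eval :: "nat \<Rightarrow> ('v \<Rightarrow> real mat) \<Rightarrow> 'v ncpoly \<Rightarrow> real mat" where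
  "nc_eval n \<sigma> p = mat n n (\<lambda>(i, j).
     \<Sum>w\<in>Poly_Mapping.keys p. Poly_Mapping.lookup p w * eval_word n \<sigma> w $$ (i, j))"

fun assign_ax :: "'g mtuple \<Rightarrow> 'g mtuple \<Rightarrow> 'g axvar \<Rightarrow> real mat" where
  "assign_ax A X (Avar j) = A j"
| "assign_ax A X (Xvar j) = X j"

fun assign_axh :: "'g mtuple \<Rightarrow> 'g mtuple \<Rightarrow> 'g mtuple \<Rightarrow> 'g axhvar \<Rightarrow> real mat" where
  "assign_axh A X H (AXvar v) = assign_ax A X v"
| "assign_axh A X H (Hvar j) = H j"

definition eval_ax :: "nat \<Rightarrow> 'g axvar ncpoly \<Rightarrow> 'g mtuple \<Rightarrow> 'g mtuple \<Rightarrow> real mat" where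
  "eval_ax n p A X = nc_eval n (assign_ax A X) p"

definition eval_axh ::
  "nat \<Rightarrow> 'g axhvar ncpoly \<Rightarrow> 'g mtuple \<Rightarrow> 'g mtuple \<Rightarrow> 'g mtuple \<Rightarrow> real mat" where
  "eval_axh n p A X H = nc_eval n (assign_axh A X H) p"

text \<open>
  Sequences \<open>(\<D>\<^sub>n)\<^sub>n\<close> are indexed by the positive integers: the value at \<open>n = 0\<close> is never
  looked at.
\<close>

definition direct_sum :: "'g mtuple \<Rightarrow> 'g mtuple \<Rightarrow> 'g mtuple" where
  "direct_sum X Y = (\<lambda>j. diag_block_mat [X j, Y j])"

definition domain1 :: "(nat \<Rightarrow> 'g mtuple set) \<Rightarrow> bool" where
  "domain1 V \<longleftrightarrow>
     (\<forall>n>0. V n \<subseteq> sym_tuples n) \<and>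
     (\<forall>m>0. \<forall>n>0. \<forall>X\<in>V m. \<forall>Y\<in>V n. direct_sum X Y \<in> V (m + n))"

definition domain2 :: "(nat \<Rightarrow> ('g mtuple \<times> 'g mtuple) set) \<Rightarrow> bool" where
  "domain2 W \<longleftrightarrow>
     (\<forall>n>0. W n \<subseteq> sym_tuples n \<times> sym_tuples n) \<and>
     (\<forall>m>0. \<forall>n>0. \<forall>(A, X)\<in>W m. \<forall>(B, Y)\<in>W n. (direct_sum A B, direct_sum X Y) \<in> W (m + n))"

definition isometry :: "nat \<Rightarrow> nat \<Rightarrow> real mat \<Rightarrow> bool" where
  "isometry m n V \<longleftrightarrow> V \<in> carrier_mat n m \<and>
     (\<forall>v\<in>carrier_vec m. (V *\<^sub>v v) \<bullet> (V *\<^sub>v v) = v \<bullet> v)"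

definition matrix_convex :: "(nat \<Rightarrow> 'g mtuple set) \<Rightarrow> bool" where
  "matrix_convex \<V> \<longleftrightarrow> domain1 \<V> \<and>
     (\<forall>m>0. \<forall>n>0. \<forall>V. isometry m n V \<longrightarrow>
        (\<forall>X\<in>\<V> n. (\<lambda>j. transpose_mat V * X j * V) \<in> \<V> m))"

text \<open>
  The usual topology of the finite-dimensional space \<open>sym_tuples n\<close>, given by the maximum norm
  of all entries.
\<close>

definition open_sym :: "nat \<Rightarrow> 'g mtuple set \<Rightarrow> bool" where
  "open_sym n U \<longleftrightarrow> U \<subseteq> sym_tuples n \<and>
     (\<forall>A\<in>U. \<exists>\<epsilon>>0. \<forall>B\<in>sym_tuples n.
        (\<forall>k. \<forall>i<n. \<forall>j<n. \<bar>B k $$ (i, j) - A k $$ (i, j)\<bar> < \<epsilon>) \<longrightarrow> B \<in> U)"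

definition open_in_a :: "(nat \<Rightarrow> ('g mtuple \<times> 'g mtuple) set) \<Rightarrow> bool" where
  "open_in_a W \<longleftrightarrow> (\<forall>n>0. \<forall>(A, X)\<in>W n. \<exists>U. open_sym n U \<and> A \<in> U \<and> U \<times> {X} \<subseteq> W n)"

definition proj_a :: "nat \<Rightarrow> ('g mtuple \<times> 'g mtuple) set \<Rightarrow> 'g mtuple set" where
  "proj_a n Wn = {A \<in> sym_tuples n. \<exists>X\<in>sym_tuples n. (A, X) \<in> Wn}"

definition globally_convex :: "nat \<Rightarrow> ('g mtuple \<Rightarrow> real mat) \<Rightarrow> bool" where
  "globally_convex n f \<longleftrightarrow>
     (\<forall>X\<in>sym_tuples n. \<forall>Y\<in>sym_tuples n. \<forall>t. 0 < t \<and> t < 1 \<longrightarrow>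
        psd n (t \<cdot>\<^sub>m f X + (1 - t) \<cdot>\<^sub>m f Y
               - f (\<lambda>j. t \<cdot>\<^sub>m X j + (1 - t) \<cdot>\<^sub>m Y j)))"

definition vanishes_on ::
  "'g axvar ncpoly \<Rightarrow> (nat \<Rightarrow> ('g mtuple \<times> 'g mtuple) set) \<Rightarrow> bool" where
  "vanishes_on q W \<longleftrightarrow> (\<forall>n>0. \<forall>(A, X)\<in>W n. eval_ax n q A X = 0\<^sub>m n n)"

end

theory Submission
  imports "HOL-Analysis.Function_Topology" Defs
begin

text \<open>
  Write \<open>p\<^sub>w\<close> for the coefficient of the word \<open>w\<close> in \<open>p\<close>. Differentiating a word twice replaces two
  of its letters \<open>x\<close> by \<open>h\<close>, so on words with exactly two letters \<open>h\<close> the coefficient of the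
  Hessian is twice the coefficient of \<open>p\<close> at the underlying word, and it is zero on all others
  (\<open>lookup_hessian_x\<close>). The proof splits on the degree of \<open>p\<close> in \<open>x\<close>.

  Suppose that this degree is at least three; then a polynomial \<open>q\<close> as in the first alternative
  exists (\<open>degree_at_least_3_imp_vanishing\<close>). Let \<open>F\<close> be the finite set of words of degree at most
  \<open>d\<^sub>a\<close> in \<open>a\<close> and \<open>d\<^sub>x - 2\<close> in \<open>x\<close>. If no nonzero combination of \<open>F\<close> vanishes on the domain, then,
  because direct sums allow functionals \<open>w \<mapsto> \<langle>\<beta>, w(A, X) \<nu>\<rangle>\<close> to be added, there are one point
  \<open>(A, X)\<close> and one vector \<open>\<nu>\<close> for which the vectors \<open>w(A, X) \<nu>\<close> with \<open>w \<in> F\<close> have a dual family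
  \<open>\<beta>\<close> (\<open>exists_dual_vectors\<close>). At the doubled point \<open>(A \<oplus> A, X \<oplus> X)\<close> a direction \<open>H\<close> with
  off-diagonal blocks \<open>K\<close> and \<open>K\<^sup>T\<close> is symmetric for every \<open>K\<close>, so each \<open>K\<^sub>j\<close> can be prescribed on the
  independent vectors \<open>w(A, X) \<nu>\<close> without any constraint. Take a word
  \<open>\<alpha> = u\<^sup>T x\<^sub>i b x\<^sub>j v\<close> of top degree in \<open>p\<close> in which \<open>u\<close> and \<open>b\<close> contain no \<open>x\<close>, and let
  \<open>K\<^sub>j\<close> send \<open>v \<nu>\<close> to \<open>\<nu>\<close> and \<open>K\<^sub>i\<close> send \<open>u \<nu>\<close> to \<open>s \<beta>\<^sub>b\<close>. The Hessian form at \<open>\<nu> \<oplus> 0\<close> is then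
  \<open>4 p\<^sub>\<alpha> s + C s\<^sup>2\<close>: its constant term would come from words \<open>v\<^sup>T x\<^sub>j w x\<^sub>j v\<close>, whose degree in
  \<open>x\<close> is at least \<open>2 d\<^sub>x - 2 > d\<^sub>x\<close>. Being nonnegative for all \<open>s\<close>, it has \<open>p\<^sub>\<alpha> = 0\<close>, a contradiction.

  If the degree is two, let \<open>p\<^sub>2\<close> be the part of \<open>p\<close> of degree two in \<open>x\<close>. The Hessian at \<open>(A, X)\<close>
  in direction \<open>H\<close> is \<open>2 p\<^sub>2(A, H)\<close>, whatever \<open>X\<close> is, and the defect in the convexity inequality is
  \<open>t (1 - t) p\<^sub>2(A, X - Y)\<close>; this gives the second alternative.

  In the product case with a nonempty \<open>\<V>\<close>, every level of \<open>\<V>\<close> is nonempty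
  (\<open>matrix_convex_nonempty\<close>), hence \<open>p\<^sub>2\<close> is positive semidefinite at all tuples of symmetric
  matrices and is a sum of hermitian squares by \<open>positive_imp_sum_of_squares\<close>, a form of Helton's
  theorem. That theorem is proved by convex duality. The sums of squares of polynomials supported
  on a finite set \<open>B\<close> of words are the images of the positive semidefinite kernels on \<open>B\<close>. A
  polynomial that is not such an image is separated from them by a functional, found by minimising
  the squared distance over a compact set of kernels (\<open>gram_kernel_or_separating_functional\<close>). Adding
  a small multiple of a strictly positive functional makes the associated Hankel kernel definite,
  and the Gelfand-Naimark-Segal construction turns the result into symmetric matrices and a vector
  at which the polynomial is negative (\<open>gns_representation\<close>). Only words with at most one \<open>x\<close> enter
  \<open>B\<close>, so comparing the parts of degree two in \<open>x\<close> discards all but the linear parts of the squares.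
\<close>

section \<open>Words acting on vectors\<close>

text \<open>
  Vectors are functions on \<open>nat\<close> of which only the values below the dimension matter. This keeps
  dimension side conditions out of the algebra; matrices still have their carriers.
\<close>

definition ip :: "nat \<Rightarrow> (nat \<Rightarrow> real) \<Rightarrow> (nat \<Rightarrow> real) \<Rightarrow> real" where
  "ip n f g = (\<Sum>i<n. f i * g i)"

definition mv :: "nat \<Rightarrow> real mat \<Rightarrow> (nat \<Rightarrow> real) \<Rightarrow> nat \<Rightarrow> real" where
  "mv n M f i = (\<Sum>k<n. M $$ (i, k) * f k)"

definition word_act :: "nat \<Rightarrow> ('v \<Rightarrow> real mat) \<Rightarrow> 'v list \<Rightarrow> (nat \<Rightarrow> real) \<Rightarrow> nat \<Rightarrow> real" where
  "word_act n \<sigma> w f = foldr (\<lambda>v. mv n (\<sigma> v)) w f"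

definition symmat :: "nat \<Rightarrow> real mat \<Rightarrow> bool" where
  "symmat n M \<longleftrightarrow> M \<in> carrier_mat n n \<and> transpose_mat M = M"

lemma word_act_simps [simp]:
  "word_act n \<sigma> [] f = f"
  "word_act n \<sigma> (v # w) f = mv n (\<sigma> v) (word_act n \<sigma> w f)"
  "word_act n \<sigma> (u @ w) f = word_act n \<sigma> u (word_act n \<sigma> w f)"
  by (simp_all add: word_act_def)

lemma ip_cong: "(\<And>i. i < n \<Longrightarrow> f i = f' i) \<Longrightarrow> (\<And>i. i < n \<Longrightarrow> g i = g' i) \<Longrightarrow> ip n f g = ip n f' g'"
  unfolding ip_def by (intro sum.cong) auto

lemma mv_cong: "(\<And>i. i < n \<Longrightarrow> f i = g i) \<Longrightarrow> mv n M f = mv n M g"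
  unfolding mv_def by (intro ext sum.cong) auto

lemma word_act_cong:
  "(\<And>i. i < n \<Longrightarrow> f i = g i) \<Longrightarrow> i < n \<Longrightarrow> word_act n \<sigma> w f i = word_act n \<sigma> w g i"
proof (induction w arbitrary: i)
  case (Cons v w)
  then have "mv n (\<sigma> v) (word_act n \<sigma> w f) = mv n (\<sigma> v) (word_act n \<sigma> w g)"
    by (intro mv_cong) auto
  then show ?case by simp
qed simp

lemma ip_commute: "ip n f g = ip n g f"
  by (simp add: ip_def mult.commute)

lemma ip_linear:
  "ip n f (\<lambda>i. a * g i + b * h i) = a * ip n f g + b * ip n f h"
  by (simp add: ip_def sum_distrib_left sum.distrib algebra_simps)

lemma mv_linear:
  "mv n M (\<lambda>i. a * g i + b * h i) = (\<lambda>i. a * mv n M g i + b * mv n M h i)"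
  by (rule ext) (simp add: mv_def sum_distrib_left sum.distrib algebra_simps)

lemma word_act_linear:
  "word_act n \<sigma> w (\<lambda>i. a * g i + b * h i)
     = (\<lambda>i. a * word_act n \<sigma> w g i + b * word_act n \<sigma> w h i)"
  by (induction w) (simp_all add: mv_linear)

lemma ip_mv_sym:
  assumes "symmat n M"
  shows "ip n (mv n M f) g = ip n f (mv n M g)"
proof -
  have s: "M $$ (i, k) = M $$ (k, i)" if "i < n" "k < n" for i k
    using assms that unfolding symmat_def by (metis carrier_matD index_transpose_mat(1))
  have "ip n (mv n M f) g = (\<Sum>i<n. \<Sum>k<n. M $$ (i, k) * f k * g i)"
    by (simp add: ip_def mv_def sum_distrib_right)
  also have "\<dots> = (\<Sum>k<n. \<Sum>i<n. M $$ (i, k) * f k * g i)"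
    by (rule sum.swap)
  also have "\<dots> = ip n f (mv n M g)"
    unfolding ip_def mv_def sum_distrib_left by (intro sum.cong refl) (simp add: s mult_ac)
  finally show ?thesis .
qed

text \<open>
  A word \<open>rev u @ v\<close> thus splits inside a quadratic form into the action of \<open>u\<close> on one side and of
  \<open>v\<close> on the other; all the positivity arguments below rest on this.
\<close>

lemma ip_word_act_rev:
  assumes "\<And>v. symmat n (\<sigma> v)"
  shows "ip n (word_act n \<sigma> u f) g = ip n f (word_act n \<sigma> (rev u) g)"
  by (induction u arbitrary: g) (simp_all add: ip_mv_sym[OF assms])

lemma eval_word_simps [simp]:
  "eval_word n \<sigma> [] = 1\<^sub>m n" "eval_word n \<sigma> (v # w) = \<sigma> v * eval_word n \<sigma> w"
  by (simp_all add: eval_word_def)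

lemma eval_word_carrier [simp]:
  assumes "\<And>v. \<sigma> v \<in> carrier_mat n n"
  shows "eval_word n \<sigma> w \<in> carrier_mat n n"
  by (induction w) (auto intro!: mult_carrier_mat assms)

lemma eval_word_Cons_entry:
  assumes "\<And>v. \<sigma> v \<in> carrier_mat n n" "i < n" "j < n"
  shows "eval_word n \<sigma> (v # w) $$ (i, j) = (\<Sum>k<n. \<sigma> v $$ (i, k) * eval_word n \<sigma> w $$ (k, j))"
proof -
  have "eval_word n \<sigma> w \<in> carrier_mat n n" and "\<sigma> v \<in> carrier_mat n n"
    using assms(1) by simp_all
  then show ?thesis
    using assms(2,3) by (auto simp: scalar_prod_def lessThan_atLeast0 intro!: sum.cong)
qed

lemma mv_eval_word:
  assumes "\<And>v. \<sigma> v \<in> carrier_mat n n" "i < n"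
  shows "mv n (eval_word n \<sigma> w) f i = word_act n \<sigma> w f i"
  using assms(2)
proof (induction w arbitrary: i)
  case Nil
  then show ?case by (simp add: mv_def if_distrib[of "\<lambda>x. x * _"] cong: if_cong)
next
  case (Cons v w)
  have "mv n (eval_word n \<sigma> (v # w)) f i
      = (\<Sum>j<n. \<Sum>k<n. \<sigma> v $$ (i, k) * eval_word n \<sigma> w $$ (k, j) * f j)"
    unfolding mv_def using Cons.prems
    by (intro sum.cong refl) (simp only: lessThan_iff eval_word_Cons_entry[OF assms(1)] sum_distrib_right)
  also have "\<dots> = (\<Sum>k<n. \<sigma> v $$ (i, k) * mv n (eval_word n \<sigma> w) f k)"
    by (subst sum.swap) (simp add: mv_def sum_distrib_left mult.assoc)
  also have "\<dots> = word_act n \<sigma> (v # w) f i"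
    using Cons.IH by (simp add: mv_def)
  finally show ?case .
qed

lemma ip_nc_eval:
  assumes "\<And>v. \<sigma> v \<in> carrier_mat n n"
  shows "ip n f (mv n (nc_eval n \<sigma> p) g)
    = (\<Sum>w\<in>Poly_Mapping.keys p. Poly_Mapping.lookup p w * ip n f (word_act n \<sigma> w g))"
proof -
  let ?K = "Poly_Mapping.keys p" and ?c = "Poly_Mapping.lookup p"
  have "mv n (nc_eval n \<sigma> p) g i = (\<Sum>w\<in>?K. ?c w * word_act n \<sigma> w g i)" if "i < n" for i
  proof -
    have "mv n (nc_eval n \<sigma> p) g i = (\<Sum>k<n. \<Sum>w\<in>?K. ?c w * eval_word n \<sigma> w $$ (i, k) * g k)"
      using that by (simp add: mv_def nc_eval_def sum_distrib_right)
    also have "\<dots> = (\<Sum>w\<in>?K. ?c w * mv n (eval_word n \<sigma> w) g i)"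
      by (subst sum.swap) (simp add: mv_def sum_distrib_left mult.assoc)
    finally show ?thesis using that by (simp add: mv_eval_word[OF assms])
  qed
  then have "ip n f (mv n (nc_eval n \<sigma> p) g) = (\<Sum>i<n. \<Sum>w\<in>?K. f i * (?c w * word_act n \<sigma> w g i))"
    by (simp add: ip_def sum_distrib_left)
  also have "\<dots> = (\<Sum>w\<in>?K. ?c w * ip n f (word_act n \<sigma> w g))"
    by (subst sum.swap) (simp add: ip_def sum_distrib_left mult_ac)
  finally show ?thesis .
qed

lemma psd_ip:
  assumes "psd n P"
  shows "0 \<le> ip n f (mv n P f)"
proof -
  have "0 \<le> vec n f \<bullet> (P *\<^sub>v vec n f)" and P: "P \<in> carrier_mat n n"
    using assms by (auto simp: psd_def)
  moreover have "vec n f \<bullet> (P *\<^sub>v vec n f) = ip n f (mv n P f)"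
    unfolding ip_def mv_def using P
    by (auto simp: scalar_prod_def lessThan_atLeast0 intro!: sum.cong)
  ultimately show ?thesis by simp
qed

definition stack :: "nat \<Rightarrow> (nat \<Rightarrow> real) \<Rightarrow> (nat \<Rightarrow> real) \<Rightarrow> nat \<Rightarrow> real" where
  "stack m f g i = (if i < m then f i else g (i - m))"

lemma sum_lessThan_add:
  fixes h :: "nat \<Rightarrow> real"
  shows "(\<Sum>i<m + n. h i) = (\<Sum>i<m. h i) + (\<Sum>i<n. h (m + i))"
  by (induction n) (simp_all add: algebra_simps)

lemma ip_stack: "ip (m + n) (stack m f g) (stack m f' g') = ip m f f' + ip n g g'"
  by (simp add: ip_def sum_lessThan_add stack_def)

lemma mv_diag_block:
  assumes "A \<in> carrier_mat m m" "B \<in> carrier_mat n n" "i < m + n"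
  shows "mv (m + n) (diag_block_mat [A, B]) (stack m f g) i = stack m (mv m A f) (mv n B g) i"
  using assms by (auto simp: mv_def sum_lessThan_add stack_def Let_def intro!: sum.cong)

lemma word_act_diag_block:
  assumes "\<And>v. \<sigma> v \<in> carrier_mat m m" "\<And>v. \<tau> v \<in> carrier_mat n n" "i < m + n"
  shows "word_act (m + n) (\<lambda>v. diag_block_mat [\<sigma> v, \<tau> v]) w (stack m f g) i
    = stack m (word_act m \<sigma> w f) (word_act n \<tau> w g) i"
  using assms(3)
proof (induction w arbitrary: i)
  case (Cons v w)
  let ?D = "\<lambda>v. diag_block_mat [\<sigma> v, \<tau> v]"
  have "mv (m + n) (?D v) (word_act (m + n) ?D w (stack m f g))
      = mv (m + n) (?D v) (stack m (word_act m \<sigma> w f) (word_act n \<tau> w g))"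
    by (rule mv_cong) (rule Cons.IH)
  then show ?case
    using mv_diag_block[OF assms(1)[of v] assms(2)[of v] Cons.prems] by simp
qed simp

lemma assign_ax_direct_sum:
  "assign_ax (direct_sum A B) (direct_sum X Y) = (\<lambda>v. diag_block_mat [assign_ax A X v, assign_ax B Y v])"
proof
  fix v :: "'a axvar" show "assign_ax (direct_sum A B) (direct_sum X Y) v = diag_block_mat [assign_ax A X v, assign_ax B Y v]"
    by (cases v) (simp_all add: direct_sum_def)
qed

lemma symmat_assign_ax: "A \<in> sym_tuples n \<Longrightarrow> X \<in> sym_tuples n \<Longrightarrow> symmat n (assign_ax A X v)"
  by (cases v) (auto simp: sym_tuples_def symmat_def)

lemma symmat_assign_axh:
  "A \<in> sym_tuples n \<Longrightarrow> X \<in> sym_tuples n \<Longrightarrow> H \<in> sym_tuples n \<Longrightarrow> symmat n (assign_axh A X H v)"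
  by (cases v) (auto simp: symmat_assign_ax, auto simp: sym_tuples_def symmat_def)

lemma symmat_carrier: "symmat n M \<Longrightarrow> M \<in> carrier_mat n n"
  by (simp add: symmat_def)

section \<open>Coefficients of the partial Hessian\<close>

fun forget_h :: "'g axhvar \<Rightarrow> 'g axvar" where
  "forget_h (AXvar v) = v"
| "forget_h (Hvar j) = Xvar j"

fun is_h :: "'g axhvar \<Rightarrow> bool" where
  "is_h (AXvar v) = False"
| "is_h (Hvar j) = True"

abbreviation h_count :: "'g axhvar list \<Rightarrow> nat" where
  "h_count W \<equiv> length (filter is_h W)"

lemma lookup_single_Nil_mult:
  "Poly_Mapping.lookup (Poly_Mapping.single [] c * q) W = c * Poly_Mapping.lookup q W"
  for q :: "'v list \<Rightarrow>\<^sub>0 'c::comm_semiring_1"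
  by (simp add: lookup_mult lookup_single when_mult plus_list_def Sum_any_when_equal)

lemma lookup_single_letter_mult:
  "Poly_Mapping.lookup (Poly_Mapping.single [v] c * q) W
    = (case W of [] \<Rightarrow> 0 | x # W' \<Rightarrow> if x = v then c * Poly_Mapping.lookup q W' else 0)"
  for q :: "'v list \<Rightarrow>\<^sub>0 'c::comm_semiring_1"
proof (cases W)
  case (Cons x W')
  show ?thesis
  proof (cases "x = v")
    case True
    then show ?thesis unfolding Cons
      by (simp add: lookup_mult lookup_single when_mult plus_list_def Sum_any_when_equal)
  next
    case False
    then show ?thesis unfolding Cons
      by (simp add: lookup_mult lookup_single when_mult plus_list_def Sum_any_when_equal)
  qed
qed (simp add: lookup_mult lookup_single when_mult plus_list_def Sum_any_when_equal)

lemma lookup_shift_var_mult: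
  "Poly_Mapping.lookup (shift_var v * q) W
    = (case W of [] \<Rightarrow> 0 | x # W' \<Rightarrow>
        if forget_h x = v then (if is_h x then [:0, 1:] else 1) * Poly_Mapping.lookup q W' else 0)"
proof (cases v)
  case (Avar j)
  show ?thesis
  proof (cases W)
    case (Cons x W')
    then show ?thesis using Avar by (cases x) (simp_all add: lookup_single_letter_mult)
  qed (simp add: lookup_single_letter_mult Avar)
next
  case (Xvar j)
  show ?thesis
  proof (cases W)
    case (Cons x W')
    then show ?thesis using Xvar
      by (cases x) (simp_all add: lookup_single_letter_mult distrib_right lookup_add)
  qed (simp add: lookup_single_letter_mult Xvar distrib_right lookup_add)
qed

text \<open>
  Multiplying out \<open>\<Prod> (x\<^sub>j + t h\<^sub>j)\<close> yields each way of replacing letters \<open>x\<close> by letters \<open>h\<close> exactly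
  once, and each replacement contributes one factor \<open>t\<close>.
\<close>

lemma lookup_shift_word:
  "Poly_Mapping.lookup (prod_list (map shift_var w)) W
    = (if map forget_h W = w then monom 1 (h_count W) else 0)"
proof (induction w arbitrary: W)
  case Nil
  then show ?case by (simp add: lookup_one zero_list_def when_def eq_commute[of W] flip: one_pCons)
next
  case (Cons v w)
  show ?case
    by (cases W) (auto simp: lookup_shift_var_mult Cons.IH monom_Suc)
qed

lemma lookup_shift_x:
  "Poly_Mapping.lookup (shift_x p) W = monom (Poly_Mapping.lookup p (map forget_h W)) (h_count W)"
proof -
  have "Poly_Mapping.lookup (shift_x p) W
      = (\<Sum>w\<in>Poly_Mapping.keys p. if w = map forget_h W then
           monom (Poly_Mapping.lookup p (map forget_h W)) (h_count W) else 0)"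
    unfolding shift_x_def lookup_sum
    by (intro sum.cong refl) (auto simp: lookup_single_Nil_mult lookup_shift_word smult_monom)
  then show ?thesis
    by (simp add: in_keys_iff)
qed

text \<open>
  Only the coefficient of \<open>t\<^sup>2\<close> survives two derivatives at zero, and it is doubled.
\<close>

lemma lookup_hessian_x:
  "Poly_Mapping.lookup (hessian_x p) W
    = (if h_count W = 2 then 2 * Poly_Mapping.lookup p (map forget_h W) else 0)"
proof -
  have "Poly_Mapping.lookup (hessian_x p) W
      = poly (pderiv (pderiv (monom (Poly_Mapping.lookup p (map forget_h W)) (h_count W)))) 0"
    by (simp add: hessian_x_def map.rep_eq when_def lookup_shift_x)
  also have "\<dots> = (if h_count W = 2 then 2 * Poly_Mapping.lookup p (map forget_h W) else 0)"
    by (auto simp: pderiv_monom poly_monom power_0_left)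
  finally show ?thesis .
qed

lemma degree_in_le:
  "degree_in P p \<le> k \<longleftrightarrow> (\<forall>w\<in>Poly_Mapping.keys p. length (filter P w) \<le> k)"
  by (simp add: degree_in_def)

lemma degree_in_attained:
  assumes "degree_in P p > 0"
  obtains w where "w \<in> Poly_Mapping.keys p" "length (filter P w) = degree_in P p"
proof -
  have "degree_in P p \<in> insert 0 ((\<lambda>w. length (filter P w)) ` Poly_Mapping.keys p)"
    unfolding degree_in_def by (rule Max_in) simp_all
  with assms that show thesis by auto
qed

lemma lookup_rev: "nc_symmetric p \<Longrightarrow> Poly_Mapping.lookup p (rev w) = Poly_Mapping.lookup p w"
proof -
  assume "nc_symmetric p"
  then have "Poly_Mapping.lookup p = Poly_Mapping.lookup p \<circ> rev"
    by (metis nc_symmetric_def nc_transpose_def map_key.rep_eq inj_on_rev)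
  then show ?thesis by (metis comp_apply)
qed

section \<open>Dual vectors at a point of the domain\<close>

text \<open>
  Finite-dimensional duality: a space of functions on \<open>F\<close> with trivial annihilator is the space of
  all functions. It produces dual vectors twice, once from the points of the domain and once in the
  representation built from a definite Hankel kernel.
\<close>

lemma separating_subspace_contains_deltas:
  fixes M :: "('w \<Rightarrow> real) set"
  assumes "finite F"
    and add: "\<And>m m'. m \<in> M \<Longrightarrow> m' \<in> M \<Longrightarrow> (\<lambda>w. m w + m' w) \<in> M"
    and scale: "\<And>c m. m \<in> M \<Longrightarrow> (\<lambda>w. c * m w) \<in> M"
    and sep: "\<And>q. (\<forall>m\<in>M. (\<Sum>w\<in>F. q w * m w) = 0) \<Longrightarrow> (\<forall>w\<in>F. q w = 0)"
    and "w0 \<in> F"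
  shows "\<exists>m\<in>M. \<forall>w\<in>F. m w = (if w = w0 then 1 else 0)"
  using assms(1,4,5)
proof (induction F arbitrary: w0)
  case (insert x F)
  have "\<exists>m\<in>M. \<forall>w\<in>F. m w = (if w = w1 then 1 else 0)" if "w1 \<in> F" for w1
  proof (rule insert.IH[OF _ that])
    fix q assume q: "\<forall>m\<in>M. (\<Sum>w\<in>F. q w * m w) = 0"
    have "(\<Sum>w\<in>insert x F. (q(x := 0)) w * m w) = (\<Sum>w\<in>F. q w * m w)" for m
    proof -
      have "(\<Sum>w\<in>F. (q(x := 0)) w * m w) = (\<Sum>w\<in>F. q w * m w)"
        using insert.hyps by (intro sum.cong) auto
      then show ?thesis using insert.hyps by simp
    qed
    then have "\<forall>w\<in>insert x F. (q(x := 0)) w = 0"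
      using q by (intro insert.prems(1)) simp
    then show "\<forall>w\<in>F. q w = 0" using insert.hyps by (metis fun_upd_other insertCI)
  qed
  then obtain D where D: "\<And>w1. w1 \<in> F \<Longrightarrow> D w1 \<in> M"
      "\<And>w1 w. w1 \<in> F \<Longrightarrow> w \<in> F \<Longrightarrow> D w1 w = (if w = w1 then 1 else 0)"
    by metis
  define q where "q w = (if w = x then 1 else - D w x)" for w
  have "\<not> (\<forall>w\<in>insert x F. q w = 0)" by (simp add: q_def)
  then obtain m where m: "m \<in> M" "(\<Sum>w\<in>insert x F. q w * m w) \<noteq> 0"
    using insert.prems(1) by blast
  have lin: "(\<lambda>v. \<Sum>w\<in>G. c w * D w v) \<in> M" if "G \<subseteq> F" for G and c :: "'w \<Rightarrow> real"
  proof -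
    have "finite G" using insert.hyps(1) that finite_subset by blast
    then show ?thesis using that
    proof (induction G)
      case empty
      then show ?case using scale[OF m(1), of 0] by simp
    next
      case (insert y G)
      then show ?case using add[OF scale[OF D(1)[of y], of "c y"]] by simp
    qed
  qed
  \<comment> \<open>Corrected by the deltas already found, \<open>m\<close> becomes zero on \<open>F\<close>; the choice of \<open>q\<close> keeps it nonzero at \<open>x\<close>.\<close>
  define m' where "m' v = m v + (\<Sum>w\<in>F. (- m w) * D w v)" for v
  have m'M: "m' \<in> M" unfolding m'_def[abs_def] by (rule add[OF m(1) lin]) simp
  have m'F: "m' v = 0" if "v \<in> F" for v
  proof -
    have "(\<Sum>w\<in>F. (- m w) * D w v) = (\<Sum>w\<in>F. if w = v then - m w else 0)"
      using D(2) that by (intro sum.cong) auto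
    then show ?thesis using that insert.hyps(1) by (simp add: m'_def)
  qed
  have "(\<Sum>w\<in>insert x F. q w * m w) = m x + (\<Sum>w\<in>F. (- D w x) * m w)"
    using insert.hyps by (auto simp: q_def intro!: sum.cong)
  also have "\<dots> = m' x" by (simp add: m'_def mult.commute)
  finally have m'x: "m' x \<noteq> 0" using m(2) by simp
  define \<gamma> where "\<gamma> v = (1 / m' x) * m' v" for v
  have \<gamma>: "\<gamma> \<in> M" "\<gamma> x = 1" "\<And>v. v \<in> F \<Longrightarrow> \<gamma> v = 0"
    using scale[OF m'M, of "1 / m' x"] m'x m'F by (auto simp: \<gamma>_def[abs_def])
  show ?case
  proof (cases "w0 = x")
    case True
    then show ?thesis using \<gamma> insert.hyps by (intro bexI[of _ \<gamma>]) auto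
  next
    case False
    then have w0: "w0 \<in> F" using insert.prems(2) by simp
    have "(\<lambda>v. D w0 v + (- D w0 x) * \<gamma> v) \<in> M"
      by (rule add[OF D(1)[OF w0] scale[OF \<gamma>(1)]])
    then show ?thesis using \<gamma> D(2)[OF w0] False by (intro bexI[of _ "\<lambda>v. D w0 v + (- D w0 x) * \<gamma> v"]) auto
  qed
qed simp

definition poly_on :: "'v list set \<Rightarrow> ('v list \<Rightarrow> real) \<Rightarrow> 'v ncpoly" where
  "poly_on F q = (\<Sum>w\<in>F. Poly_Mapping.single w (q w))"

lemma lookup_poly_on:
  "finite F \<Longrightarrow> Poly_Mapping.lookup (poly_on F q) w = (if w \<in> F then q w else 0)"
  by (simp add: poly_on_def lookup_sum lookup_single when_def)

lemma keys_poly_on: "finite F \<Longrightarrow> Poly_Mapping.keys (poly_on F q) \<subseteq> F"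
  by (auto simp: in_keys_iff lookup_poly_on split: if_splits)

lemma ip_word_act_direct_sum:
  assumes "A \<in> sym_tuples m" "X \<in> sym_tuples m" "B \<in> sym_tuples n" "Y \<in> sym_tuples n"
  shows "ip (m + n) (stack m \<beta> \<beta>')
      (word_act (m + n) (assign_ax (direct_sum A B) (direct_sum X Y)) w (stack m \<nu> \<nu>'))
    = ip m \<beta> (word_act m (assign_ax A X) w \<nu>) + ip n \<beta>' (word_act n (assign_ax B Y) w \<nu>')"
proof -
  note c = symmat_carrier[OF symmat_assign_ax[OF assms(1,2)]] symmat_carrier[OF symmat_assign_ax[OF assms(3,4)]]
  show ?thesis
    unfolding assign_ax_direct_sum ip_stack[symmetric]
    by (intro ip_cong refl word_act_diag_block c)
qed

definition unit_fun :: "nat \<Rightarrow> nat \<Rightarrow> real" where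
  "unit_fun i = (\<lambda>k. if k = i then 1 else 0)"

lemma ip_unit_fun_mv: "i < n \<Longrightarrow> j < n \<Longrightarrow> ip n (unit_fun i) (mv n M (unit_fun j)) = M $$ (i, j)"
  by (simp add: ip_def mv_def unit_fun_def if_distrib[of "\<lambda>x. x * _"] if_distrib[of "\<lambda>x. _ * x"] cong: if_cong)

lemma ip_zero_left [simp]: "ip n (\<lambda>_. 0) g = 0"
  by (simp add: ip_def)

lemma domain2_subset: "domain2 W \<Longrightarrow> n > 0 \<Longrightarrow> (A, X) \<in> W n \<Longrightarrow> A \<in> sym_tuples n \<and> X \<in> sym_tuples n"
  unfolding domain2_def by (elim conjE allE[of _ n] impE) (assumption, auto)

lemma domain2_direct_sum:
  assumes "domain2 W" "m > 0" "n > 0" "(A, X) \<in> W m" "(B, Y) \<in> W n"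
  shows "(direct_sum A B, direct_sum X Y) \<in> W (m + n)"
proof -
  have "\<forall>(A, X)\<in>W m. \<forall>(B, Y)\<in>W n. (direct_sum A B, direct_sum X Y) \<in> W (m + n)"
    using assms(1-3) by (simp add: domain2_def)
  from bspec[OF this assms(4)] have "\<forall>(B, Y)\<in>W n. (direct_sum A B, direct_sum X Y) \<in> W (m + n)"
    by simp
  from bspec[OF this assms(5)] show ?thesis by simp
qed

text \<open>
  The functionals \<open>w \<mapsto> \<langle>\<beta>, w(A, X) \<nu>\<rangle>\<close>, over all points of the domain, form a subspace because the
  domain is closed under direct sums. A combination of words annihilated by all of them vanishes on
  the domain, so the subspace contains the deltas of \<open>F\<close>. These live at different points; one more
  direct sum brings them to a common point and a common \<open>\<nu>\<close>.
\<close>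

lemma exists_dual_vectors:
  fixes W :: "nat \<Rightarrow> ('g mtuple \<times> 'g mtuple) set" and F :: "'g axvar list set"
  assumes F: "finite F" "F \<noteq> {}" and W: "domain2 W"
    and nv: "\<And>q. q \<noteq> 0 \<Longrightarrow> Poly_Mapping.keys q \<subseteq> F \<Longrightarrow> \<not> vanishes_on q W"
  shows "\<exists>n A X \<nu> \<beta>. n > 0 \<and> (A, X) \<in> W n \<and> (\<forall>w0\<in>F. \<forall>w\<in>F.
           ip n (\<beta> w0) (word_act n (assign_ax A X) w \<nu>) = (if w = w0 then 1 else 0))"
proof -
  define M where "M = {m. \<exists>n A X \<beta> \<nu>. n > 0 \<and> (A, X) \<in> W n \<and>
      m = (\<lambda>w. ip n \<beta> (word_act n (assign_ax A X) w \<nu>))}"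
  have Wsym: "A \<in> sym_tuples n" "X \<in> sym_tuples n" if "n > 0" "(A, X) \<in> W n" for n A X
    using domain2_subset[OF W that] by simp_all
  note Wsum = domain2_direct_sum[OF W]
  have MI: "(\<lambda>w. ip n \<beta> (word_act n (assign_ax A X) w \<nu>)) \<in> M"
    if "n > 0" "(A, X) \<in> W n" for n A X \<beta> \<nu>
    unfolding M_def mem_Collect_eq using that by (intro exI conjI) (assumption+, rule refl)
  have ME: "\<exists>n A X \<beta> \<nu>. n > 0 \<and> (A, X) \<in> W n \<and>
      m = (\<lambda>w. ip n \<beta> (word_act n (assign_ax A X) w \<nu>))" if "m \<in> M" for m
    using that unfolding M_def mem_Collect_eq .
  have deltas: "\<exists>m\<in>M. \<forall>w\<in>F. m w = (if w = w0 then 1 else 0)" if "w0 \<in> F" for w0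
  proof (rule separating_subspace_contains_deltas[OF F(1) _ _ _ that])
    fix m m' assume "m \<in> M" "m' \<in> M"
    from ME[OF this(1)] ME[OF this(2)]
    obtain n A X \<beta> \<nu> n' A' X' \<beta>' \<nu>' where
      1: "n > 0" "(A, X) \<in> W n" "m = (\<lambda>w. ip n \<beta> (word_act n (assign_ax A X) w \<nu>))" and
      2: "n' > 0" "(A', X') \<in> W n'" "m' = (\<lambda>w. ip n' \<beta>' (word_act n' (assign_ax A' X') w \<nu>'))"
      by (elim exE conjE) (rule that)
    have "(\<lambda>w. m w + m' w) = (\<lambda>w. ip (n + n') (stack n \<beta> \<beta>')
        (word_act (n + n') (assign_ax (direct_sum A A') (direct_sum X X')) w (stack n \<nu> \<nu>')))"
      using Wsym 1 2 by (simp add: ip_word_act_direct_sum)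
    moreover have "n + n' > 0" using 1(1) by simp
    ultimately show "(\<lambda>w. m w + m' w) \<in> M"
      using MI Wsum[OF 1(1) 2(1) 1(2) 2(2)] by simp
  next
    fix c m assume "m \<in> M"
    from ME[OF this] obtain n A X \<beta> \<nu> where
      1: "n > 0" "(A, X) \<in> W n" "m = (\<lambda>w. ip n \<beta> (word_act n (assign_ax A X) w \<nu>))"
      by (elim exE conjE) (rule that)
    have "(\<lambda>w. c * m w) = (\<lambda>w. ip n (\<lambda>i. c * \<beta> i) (word_act n (assign_ax A X) w \<nu>))"
      by (simp add: 1(3) ip_def sum_distrib_left mult.assoc)
    then show "(\<lambda>w. c * m w) \<in> M" using MI[OF 1(1,2)] by simp
  next
    fix q assume q: "\<forall>m\<in>M. (\<Sum>w\<in>F. q w * m w) = 0"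
    have "vanishes_on (poly_on F q) W"
      unfolding vanishes_on_def
    proof (intro allI impI, clarify)
      fix n :: nat and A X assume n: "n > 0" and AX: "(A, X) \<in> W n"
      let ?\<sigma> = "assign_ax A X"
      note c = symmat_carrier[OF symmat_assign_ax[OF Wsym[OF n AX]]]
      have "nc_eval n ?\<sigma> (poly_on F q) $$ (i, j) = 0" if "i < n" "j < n" for i j
      proof -
        have "nc_eval n ?\<sigma> (poly_on F q) $$ (i, j)
            = ip n (unit_fun i) (mv n (nc_eval n ?\<sigma> (poly_on F q)) (unit_fun j))"
          using that by (simp add: ip_unit_fun_mv)
        also have "\<dots> = (\<Sum>w\<in>F. q w * ip n (unit_fun i) (word_act n ?\<sigma> w (unit_fun j)))"
          unfolding ip_nc_eval[OF c]
          by (rule sum.mono_neutral_cong_left[OF F(1) keys_poly_on[OF F(1)]])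
            (auto simp: in_keys_iff lookup_poly_on[OF F(1)])
        also have "\<dots> = 0" using bspec[OF q MI[OF n AX]] by simp
        finally show ?thesis .
      qed
      then show "eval_ax n (poly_on F q) A X = 0\<^sub>m n n"
        by (intro eq_matI) (auto simp: eval_ax_def nc_eval_def)
    qed
    with nv[OF _ keys_poly_on[OF F(1)]] have "poly_on F q = 0" by blast
    then show "\<forall>w\<in>F. q w = 0" using lookup_poly_on[OF F(1), of q] by (metis lookup_zero)
  qed
  have "\<exists>n A X \<nu> \<beta>. n > 0 \<and> (A, X) \<in> W n \<and> (\<forall>w0\<in>G. \<forall>w\<in>F.
           ip n (\<beta> w0) (word_act n (assign_ax A X) w \<nu>) = (if w = w0 then 1 else 0))"
    if "finite G" "G \<noteq> {}" "G \<subseteq> F" for G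
    using that
  proof (induction G rule: finite_ne_induct)
    case (singleton x)
    then obtain m where m: "m \<in> M" "\<forall>w\<in>F. m w = (if w = x then 1 else 0)"
      using deltas[of x] by auto
    from ME[OF m(1)] obtain n A X \<beta> \<nu> where "n > 0" "(A, X) \<in> W n"
      "m = (\<lambda>w. ip n \<beta> (word_act n (assign_ax A X) w \<nu>))"
      by (elim exE conjE) (rule that)
    with m(2) have "n > 0" "(A, X) \<in> W n"
      "\<forall>w\<in>F. ip n \<beta> (word_act n (assign_ax A X) w \<nu>) = (if w = x then 1 else 0)"
      by simp_all
    then show ?case by (intro exI[of _ n] exI[of _ A] exI[of _ X] exI[of _ \<nu>] exI[of _ "\<lambda>_. \<beta>"]) auto
  next
    case (insert x G)
    obtain n A X \<nu> \<beta> where 1: "n > 0" "(A, X) \<in> W n"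
      "\<forall>w0\<in>G. \<forall>w\<in>F. ip n (\<beta> w0) (word_act n (assign_ax A X) w \<nu>) = (if w = w0 then 1 else 0)"
      using insert.IH insert.prems by (elim meta_impE exE conjE) (blast, rule that)
    obtain m where m: "m \<in> M" "\<forall>w\<in>F. m w = (if w = x then 1 else 0)"
      using deltas[of x] insert.prems by auto
    from ME[OF m(1)] obtain n' A' X' \<beta>' \<nu>' where m': "n' > 0" "(A', X') \<in> W n'"
      "m = (\<lambda>w. ip n' \<beta>' (word_act n' (assign_ax A' X') w \<nu>'))"
      by (elim exE conjE) (rule that)
    with m(2) have 2: "n' > 0" "(A', X') \<in> W n'"
      "\<forall>w\<in>F. ip n' \<beta>' (word_act n' (assign_ax A' X') w \<nu>') = (if w = x then 1 else 0)"
      by simp_all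
    \<comment> \<open>Padding with zeros makes each functional see only its own summand, although \<open>\<nu>\<close> is now shared.\<close>
    define \<gamma> where "\<gamma> w0 = (if w0 = x then stack n (\<lambda>_. 0) \<beta>' else stack n (\<beta> w0) (\<lambda>_. 0))" for w0
    have "ip (n + n') (\<gamma> w0) (word_act (n + n') (assign_ax (direct_sum A A') (direct_sum X X')) w (stack n \<nu> \<nu>'))
        = (if w = w0 then 1 else 0)" if "w0 \<in> insert x G" "w \<in> F" for w0 w
      using that 1 2 Wsym by (auto simp: \<gamma>_def ip_word_act_direct_sum)
    then show ?case using Wsum[OF 1(1) 2(1) 1(2) 2(2)] 1(1)
      by (intro exI[of _ "n + n'"] exI[of _ "direct_sum A A'"] exI[of _ "direct_sum X X'"]
          exI[of _ "stack n \<nu> \<nu>'"] exI[of _ \<gamma>]) auto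
  qed
  from this[OF F subset_refl] show ?thesis .
qed

section \<open>The Hessian at a doubled point\<close>

text \<open>
  The symmetric block matrix with zero diagonal blocks, lower left block \<open>K\<close> and upper right block
  \<open>K\<^sup>T\<close>.
\<close>

definition off_diag :: "nat \<Rightarrow> (nat \<Rightarrow> nat \<Rightarrow> real) \<Rightarrow> real mat" where
  "off_diag n K = mat (n + n) (n + n) (\<lambda>(r, c).
     if r < n \<and> n \<le> c then K (c - n) r else if n \<le> r \<and> c < n then K (r - n) c else 0)"

lemma symmat_off_diag: "symmat (n + n) (off_diag n K)"
  unfolding symmat_def by (auto simp: off_diag_def intro!: eq_matI)

lemma mv_off_diag:
  "i < n + n \<Longrightarrow> mv (n + n) (off_diag n K) (stack n f (\<lambda>_. 0)) i
    = stack n (\<lambda>_. 0) (\<lambda>i. \<Sum>k<n. K i k * f k) i"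
  by (auto simp: mv_def off_diag_def stack_def sum_lessThan_add)

lemma word_act_map: "word_act n \<sigma> (map f w) g = word_act n (\<lambda>v. \<sigma> (f v)) w g"
  by (induction w) simp_all

lemma word_act_zero: "word_act n \<sigma> w (\<lambda>_. 0) = (\<lambda>_. 0)"
  by (induction w) (auto simp: mv_def)

text \<open>
  The words of the Hessian, parametrised by what stands around their two letters \<open>h\<close>. The first
  entry is reversed since it acts on the left argument of the quadratic form.
\<close>

definition two_h :: "'g axvar list \<times> 'g \<times> 'g axvar list \<times> 'g \<times> 'g axvar list \<Rightarrow> 'g axhvar list" where
  "two_h = (\<lambda>(a, i, b, j, c). map AXvar (rev a) @ Hvar i # map AXvar b @ Hvar j # map AXvar c)"

lemma map_AXvar_Hvar_eq_iff:
  "map AXvar u @ Hvar i # U = map AXvar u' @ Hvar i' # U' \<longleftrightarrow> u = u' \<and> i = i' \<and> U = U'"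
proof (induction u arbitrary: u')
  case Nil
  then show ?case by (cases u') auto
next
  case (Cons x u)
  then show ?case by (cases u') auto
qed

lemma inj_AXvar: "inj AXvar"
  by (auto intro: injI)

lemma inj_two_h: "inj two_h"
proof (rule injI)
  fix s t :: "'a axvar list \<times> 'a \<times> 'a axvar list \<times> 'a \<times> 'a axvar list"
  assume "two_h s = two_h t"
  then show "s = t"
    by (cases s, cases t) (auto simp: two_h_def map_AXvar_Hvar_eq_iff inj_map_eq_map[OF inj_AXvar])
qed

lemma map_AXvar_forget_h: "(\<And>x. x \<in> set U \<Longrightarrow> \<not> is_h x) \<Longrightarrow> U = map AXvar (map forget_h U)"
proof (induction U)
  case (Cons x U)
  then have "\<not> is_h x" "U = map AXvar (map forget_h U)" by simp_all
  then show ?case by (cases x) auto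
qed simp

lemma h_count_2_iff: "h_count W = 2 \<longleftrightarrow> W \<in> range two_h"
proof
  assume "h_count W = 2"
  then obtain x y where xy: "filter is_h W = [x, y]"
    by (auto simp: numeral_2_eq_2 length_Suc_conv)
  from filter_eq_ConsD[OF xy] obtain U V where
    1: "W = U @ x # V" "\<forall>u\<in>set U. \<not> is_h u" "is_h x" "filter is_h V = [y]"
    by (elim exE conjE) (rule that, assumption+, rule sym)
  from filter_eq_ConsD[OF 1(4)] obtain V' Z where
    2: "V = V' @ y # Z" "\<forall>u\<in>set V'. \<not> is_h u" "is_h y" "[] = filter is_h Z"
    by (elim exE conjE) (rule that)
  then have Z: "\<forall>u\<in>set Z. \<not> is_h u" by (metis filter_empty_conv)
  obtain i j where ij: "x = Hvar i" "y = Hvar j" using 1(3) 2(3) by (cases x; cases y) auto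
  have "W = two_h (rev (map forget_h U), i, map forget_h V', j, map forget_h Z)"
    using map_AXvar_forget_h[of U] map_AXvar_forget_h[of V'] map_AXvar_forget_h[of Z] 1 2 Z ij
    by (simp add: two_h_def rev_map)
  then show "W \<in> range two_h" by blast
next
  have f: "filter is_h (map AXvar u) = []" for u :: "'a axvar list" by (induction u) auto
  assume "W \<in> range two_h"
  then show "h_count W = 2" by (auto simp: two_h_def f)
qed

lemma map_forget_two_h: "map forget_h (two_h (a, i, b, j, c)) = rev a @ Xvar i # b @ Xvar j # c"
proof -
  have f: "map (\<lambda>x. forget_h (AXvar x)) u = u" for u :: "'a axvar list" by (induction u) auto
  show ?thesis by (simp add: two_h_def comp_def f)
qed

lemma symmat_diag_block:
  assumes "symmat m A" "symmat n B"
  shows "symmat (m + n) (diag_block_mat [A, B])"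
proof -
  have A: "A \<in> carrier_mat m m" "\<And>i k. i < m \<Longrightarrow> k < m \<Longrightarrow> A $$ (i, k) = A $$ (k, i)"
    using assms(1) unfolding symmat_def by (simp, metis carrier_matD index_transpose_mat(1))
  have B: "B \<in> carrier_mat n n" "\<And>i k. i < n \<Longrightarrow> k < n \<Longrightarrow> B $$ (i, k) = B $$ (k, i)"
    using assms(2) unfolding symmat_def by (simp, metis carrier_matD index_transpose_mat(1))
  show ?thesis
    unfolding symmat_def
  proof
    show "transpose_mat (diag_block_mat [A, B]) = diag_block_mat [A, B]"
      using A B by (intro eq_matI) (auto simp: Let_def)
  qed (use A B in \<open>auto simp: Let_def\<close>)
qed

text \<open>
  The first \<open>h\<close> moves the first summand into the second through \<open>K\<close>, the middle part acts there, and
  the other \<open>h\<close> comes back; so the form becomes one on the undoubled space in which \<open>K\<close> is arbitrary.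
\<close>

lemma two_h_at_doubled_point:
  assumes A: "A \<in> sym_tuples n" and X: "X \<in> sym_tuples n"
  shows "ip (n + n) (stack n \<nu> (\<lambda>_. 0))
      (word_act (n + n) (assign_axh (direct_sum A A) (direct_sum X X) (\<lambda>j. off_diag n (K j)))
        (two_h (a, i, b, j, c)) (stack n \<nu> (\<lambda>_. 0)))
    = ip n (\<lambda>l. \<Sum>k<n. K i l k * word_act n (assign_ax A X) a \<nu> k)
        (word_act n (assign_ax A X) b (\<lambda>l. \<Sum>k<n. K j l k * word_act n (assign_ax A X) c \<nu> k))"
proof -
  let ?N = "n + n" and ?O = "\<lambda>_. 0 :: real" and ?\<alpha> = "assign_ax A X"
  let ?\<alpha>2 = "assign_ax (direct_sum A A) (direct_sum X X)"
  let ?\<sigma> = "assign_axh (direct_sum A A) (direct_sum X X) (\<lambda>j. off_diag n (K j))"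
  let ?KK = "\<lambda>j f l. \<Sum>k<n. K j l k * f k"
  let ?\<nu> = "stack n \<nu> ?O"
  note car = symmat_carrier[OF symmat_assign_ax[OF A X]]
  have ds: "direct_sum Y Y \<in> sym_tuples (n + n)" if "Y \<in> sym_tuples n" for Y :: "'a mtuple"
    using that symmat_diag_block[of n _ n] unfolding sym_tuples_def symmat_def direct_sum_def by blast
  have sym2: "symmat ?N (?\<alpha>2 v)" for v by (rule symmat_assign_ax[OF ds[OF A] ds[OF X]])
  have act1: "word_act ?N ?\<sigma> (map AXvar w) g = word_act ?N ?\<alpha>2 w g" for w g
    by (simp add: word_act_map)
  have act2: "word_act ?N ?\<alpha>2 w (stack n f g) l = stack n (word_act n ?\<alpha> w f) (word_act n ?\<alpha> w g) l"
    if "l < ?N" for w f g l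
    unfolding assign_ax_direct_sum by (rule word_act_diag_block[OF car car that])
  have hstep: "mv ?N (off_diag n (K j)) (word_act ?N ?\<alpha>2 c ?\<nu>) l
      = stack n ?O (?KK j (word_act n ?\<alpha> c \<nu>)) l" if "l < ?N" for j c l
  proof -
    have "mv ?N (off_diag n (K j)) (word_act ?N ?\<alpha>2 c ?\<nu>)
        = mv ?N (off_diag n (K j)) (stack n (word_act n ?\<alpha> c \<nu>) ?O)"
      by (rule mv_cong) (simp add: act2 word_act_zero)
    then show ?thesis using that by (simp add: mv_off_diag)
  qed
  have "ip ?N ?\<nu> (word_act ?N ?\<sigma> (two_h (a, i, b, j, c)) ?\<nu>)
      = ip ?N ?\<nu> (word_act ?N ?\<alpha>2 (rev a) (mv ?N (off_diag n (K i))
          (word_act ?N ?\<alpha>2 b (mv ?N (off_diag n (K j)) (word_act ?N ?\<alpha>2 c ?\<nu>)))))"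
    by (simp add: two_h_def act1)
  also have "\<dots> = ip ?N (mv ?N (off_diag n (K i)) (word_act ?N ?\<alpha>2 a ?\<nu>))
          (word_act ?N ?\<alpha>2 b (mv ?N (off_diag n (K j)) (word_act ?N ?\<alpha>2 c ?\<nu>)))"
    by (simp only: ip_word_act_rev[OF sym2] ip_mv_sym[OF symmat_off_diag])
  also have "\<dots> = ip ?N (stack n ?O (?KK i (word_act n ?\<alpha> a \<nu>)))
          (stack n ?O (word_act n ?\<alpha> b (?KK j (word_act n ?\<alpha> c \<nu>))))"
  proof (rule ip_cong)
    fix l assume l: "l < ?N"
    have "word_act ?N ?\<alpha>2 b (mv ?N (off_diag n (K j)) (word_act ?N ?\<alpha>2 c ?\<nu>)) l
        = word_act ?N ?\<alpha>2 b (stack n ?O (?KK j (word_act n ?\<alpha> c \<nu>))) l"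
      by (rule word_act_cong[OF hstep l])
    then show "word_act ?N ?\<alpha>2 b (mv ?N (off_diag n (K j)) (word_act ?N ?\<alpha>2 c ?\<nu>)) l
        = stack n ?O (word_act n ?\<alpha> b (?KK j (word_act n ?\<alpha> c \<nu>))) l"
      using l by (simp add: act2 word_act_zero)
  qed (rule hstep)
  finally show ?thesis by (simp add: ip_stack)
qed

lemma linear_coeff_zero:
  fixes b c :: real
  assumes "\<And>s. 0 \<le> s * b + s\<^sup>2 * c"
  shows "b = 0"
proof (rule ccontr)
  assume b: "b \<noteq> 0"
  define d where "d = \<bar>c\<bar> + 1"
  have d: "d > 0" "c < d" by (auto simp: d_def)
  have "0 \<le> (- b / d) * b + (- b / d)\<^sup>2 * c" by (rule assms)
  also have "\<dots> = b\<^sup>2 * (c - d) / d\<^sup>2" using d(1) by (simp add: field_simps power2_eq_square)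
  also have "\<dots> < 0" using b d by (intro divide_neg_pos mult_pos_neg) auto
  finally show False by simp
qed

section \<open>Degree at least three in x\<close>

lemma finite_axvar: "finite (UNIV :: 'g::finite axvar set)"
proof -
  have "v \<in> range Avar \<union> range Xvar" for v :: "'g axvar" by (cases v) auto
  then have "UNIV = range Avar \<union> (range Xvar :: 'g axvar set)" by blast
  moreover have "finite (range Avar \<union> (range Xvar :: 'g axvar set))" by simp
  ultimately show ?thesis by simp
qed

lemma length_eq_degrees: "length w = length (filter is_Avar w) + length (filter is_Xvar w)"
proof (induction w)
  case (Cons v w)
  then show ?case by (cases v) auto
qed simp

lemma finite_bounded_words:
  "finite {w :: 'g::finite axvar list. length (filter is_Avar w) \<le> k \<and> length (filter is_Xvar w) \<le> l}"
proof (rule finite_subset[OF _ finite_lists_length_le[OF finite_axvar, of "k + l"]], rule subsetI)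
  fix w :: "'g axvar list"
  assume "w \<in> {w. length (filter is_Avar w) \<le> k \<and> length (filter is_Xvar w) \<le> l}"
  then show "w \<in> {w. set w \<subseteq> UNIV \<and> length w \<le> k + l}"
    using length_eq_degrees[of w] by simp
qed

lemma split_first_two_x:
  assumes "length (filter is_Xvar w) \<ge> 2"
  obtains a i b j c where "w = a @ Xvar i # b @ Xvar j # c"
    "filter is_Xvar a = []" "filter is_Xvar b = []" "length (filter is_Xvar w) = length (filter is_Xvar c) + 2"
proof -
  obtain x y zs where xy: "filter is_Xvar w = x # y # zs"
    using assms by (metis Suc_le_length_iff numeral_2_eq_2)
  from filter_eq_ConsD[OF xy] obtain a W where
    1: "w = a @ x # W" "\<forall>u\<in>set a. \<not> is_Xvar u" "is_Xvar x" "filter is_Xvar W = y # zs"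
    by (elim exE conjE) (rule that, assumption+, rule sym)
  from filter_eq_ConsD[OF 1(4)] obtain b c where
    2: "W = b @ y # c" "\<forall>u\<in>set b. \<not> is_Xvar u" "is_Xvar y" "zs = filter is_Xvar c"
    by (elim exE conjE) (rule that)
  obtain i j where "x = Xvar i" "y = Xvar j" using 1(3) 2(3) by (cases x; cases y) auto
  then show thesis
    using 1 2 xy by (intro that[of a i b j c]) (auto simp: filter_empty_conv)
qed

text \<open>
  The contradiction comes from a block of the middle matrix of the Hessian: a zero on the diagonal,
  forced by the degree, next to an off-diagonal entry containing \<open>p\<^sub>\<alpha>\<close>.
\<close>

lemma degree_at_least_3_imp_vanishing:
  fixes p :: "'g::finite axvar ncpoly"
  assumes sym: "nc_symmetric p" and W: "domain2 W" and deg: "degree_x p \<ge> 3"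
    and psd: "\<And>n A X H. n > 0 \<Longrightarrow> (A, X) \<in> W n \<Longrightarrow> H \<in> sym_tuples n \<Longrightarrow>
           psd n (eval_axh n (hessian_x p) A X H)"
  shows "\<exists>q. q \<noteq> 0 \<and> degree_a q \<le> degree_a p \<and> degree_x q \<le> degree_x p - 2 \<and> vanishes_on q W"
proof (rule ccontr)
  assume contra: "\<not> ?thesis"
  let ?P = "Poly_Mapping.lookup p"
  define F where "F = {w :: 'g axvar list. length (filter is_Avar w) \<le> degree_a p \<and>
      length (filter is_Xvar w) \<le> degree_x p - 2}"
  have finF: "finite F" unfolding F_def by (rule finite_bounded_words)
  have "[] \<in> F" by (simp add: F_def)
  then have Fne: "F \<noteq> {}" by blast
  have nv: "\<not> vanishes_on q W" if "q \<noteq> 0" "Poly_Mapping.keys q \<subseteq> F" for q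
  proof
    assume "vanishes_on q W"
    moreover have "degree_a q \<le> degree_a p" "degree_x q \<le> degree_x p - 2"
      using that(2) by (auto simp: degree_in_le F_def)
    ultimately show False using contra that(1) by blast
  qed
  have "\<exists>n A X \<nu> \<beta>. n > 0 \<and> (A, X) \<in> W n \<and> (\<forall>w0\<in>F. \<forall>w\<in>F.
      ip n (\<beta> w0) (word_act n (assign_ax A X) w \<nu>) = (if w = w0 then 1 else 0))"
    by (rule exists_dual_vectors[OF finF Fne W]) (rule nv)
  then obtain n A X \<nu> \<beta> where n: "n > 0" and AX: "(A, X) \<in> W n" and
    dual: "\<forall>w0\<in>F. \<forall>w\<in>F. ip n (\<beta> w0) (word_act n (assign_ax A X) w \<nu>) = (if w = w0 then 1 else 0)"
    by (elim exE conjE) (rule that)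
  have A: "A \<in> sym_tuples n" and X: "X \<in> sym_tuples n"
    using domain2_subset[OF W n AX] by simp_all
  let ?act = "word_act n (assign_ax A X)"

  have keys_deg: "length (filter is_Avar w) \<le> degree_a p \<and> length (filter is_Xvar w) \<le> degree_x p"
    if "?P w \<noteq> 0" for w
    using degree_in_le[of is_Avar p "degree_a p"] degree_in_le[of is_Xvar p "degree_x p"] that
    by (simp add: in_keys_iff)
  obtain \<alpha> where \<alpha>: "?P \<alpha> \<noteq> 0" "length (filter is_Xvar \<alpha>) = degree_x p"
    using degree_in_attained[of is_Xvar p] deg by (auto simp: in_keys_iff)
  have "length (filter is_Xvar \<alpha>) \<ge> 2" using \<alpha>(2) deg by simp
  from split_first_two_x[OF this] obtain a0 i0 b0 j0 v0 where split: "\<alpha> = a0 @ Xvar i0 # b0 @ Xvar j0 # v0"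
    "filter is_Xvar a0 = []" "filter is_Xvar b0 = []" "degree_x p = length (filter is_Xvar v0) + 2"
    unfolding \<alpha>(2) by metis
  define u0 where "u0 = rev a0"
  have u0x: "filter is_Xvar u0 = []" by (simp add: u0_def split(2) flip: rev_filter)
  have inF: "u0 \<in> F" "b0 \<in> F" "v0 \<in> F" "rev b0 \<in> F"
    using keys_deg[OF \<alpha>(1)] split u0x unfolding F_def u0_def
    by (simp_all flip: rev_filter)
  have u0v0: "u0 \<noteq> v0" using u0x split(4) deg by auto

  \<comment> \<open>The matrix \<open>K j\<close> is chosen to send \<open>v0 \<nu>\<close> to \<open>\<nu>\<close> if \<open>j = j0\<close> and \<open>u0 \<nu>\<close> to \<open>s \<beta> b0\<close> if \<open>j = i0\<close>, and every other word of \<open>F\<close> applied to \<open>\<nu>\<close> to zero.\<close>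
  define K where "K s j l k = (if j = j0 then \<nu> l * \<beta> v0 k else 0)
      + s * (if j = i0 then \<beta> b0 l * \<beta> u0 k else 0)" for s :: real and j l k
  define P Q where "P j c = (if j = j0 \<and> c = v0 then 1 else 0 :: real)"
    and "Q j c = (if j = i0 \<and> c = u0 then 1 else 0 :: real)" for j c
  have K: "(\<lambda>l. \<Sum>k<n. K s j l k * ?act c \<nu> k) = (\<lambda>l. P j c * \<nu> l + (s * Q j c) * \<beta> b0 l)"
    if "c \<in> F" for s j c
  proof
    fix l
    have "(\<Sum>k<n. K s j l k * ?act c \<nu> k)
        = (if j = j0 then \<nu> l else 0) * ip n (\<beta> v0) (?act c \<nu>) + s * (if j = i0 then \<beta> b0 l else 0) * ip n (\<beta> u0) (?act c \<nu>)"
      unfolding K_def ip_def by (auto simp: sum_distrib_left sum.distrib algebra_simps)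
    then show "(\<Sum>k<n. K s j l k * ?act c \<nu> k) = P j c * \<nu> l + (s * Q j c) * \<beta> b0 l"
      using dual inF that by (auto simp: P_def Q_def)
  qed

  define I where "I = two_h -` Poly_Mapping.keys (hessian_x p)"
  have finI: "finite I" unfolding I_def by (rule finite_vimageI[OF finite_keys inj_two_h])
  have img: "two_h ` I = Poly_Mapping.keys (hessian_x p)"
  proof -
    have "Poly_Mapping.keys (hessian_x p) \<subseteq> range two_h"
      by (auto simp: in_keys_iff lookup_hessian_x h_count_2_iff[symmetric] split: if_splits)
    then show ?thesis unfolding I_def by blast
  qed
  have look: "Poly_Mapping.lookup (hessian_x p) (two_h (a, i, b, j, c)) = 2 * ?P (rev a @ Xvar i # b @ Xvar j # c)"
    for a i b j c
    using h_count_2_iff[of "two_h (a, i, b, j, c)"] by (simp add: lookup_hessian_x map_forget_two_h)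
  have I_F: "a \<in> F \<and> b \<in> F \<and> c \<in> F" if "(a, i, b, j, c) \<in> I" for a i b j c
  proof -
    have "?P (rev a @ Xvar i # b @ Xvar j # c) \<noteq> 0"
      using that by (simp add: I_def in_keys_iff look)
    from keys_deg[OF this]
    have "length (filter is_Avar a) + (length (filter is_Avar b) + length (filter is_Avar c)) \<le> degree_a p"
      "Suc (Suc (length (filter is_Xvar a) + (length (filter is_Xvar b) + length (filter is_Xvar c)))) \<le> degree_x p"
      by (simp_all flip: rev_filter)
    then show ?thesis unfolding F_def by auto
  qed

  \<comment> \<open>The contributions of one word of the Hessian to the coefficients of \<open>1\<close>, \<open>s\<close> and \<open>s\<^sup>2\<close>.\<close>
  define T0 T1 T2 where
    "T0 = (\<lambda>(a, i, b, j, c). 2 * ?P (rev a @ Xvar i # b @ Xvar j # c) * (P i a * P j c * ip n \<nu> (?act b \<nu>)))" and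
    "T1 = (\<lambda>(a, i, b, j, c). 2 * ?P (rev a @ Xvar i # b @ Xvar j # c) *
        (P i a * Q j c * ip n \<nu> (?act b (\<beta> b0)) + Q i a * P j c * ip n (\<beta> b0) (?act b \<nu>)))" and
    "T2 = (\<lambda>(a, i, b, j, c). 2 * ?P (rev a @ Xvar i # b @ Xvar j # c) * (Q i a * Q j c * ip n (\<beta> b0) (?act b (\<beta> b0))))"
  have form: "0 \<le> (\<Sum>t\<in>I. T0 t) + s * (\<Sum>t\<in>I. T1 t) + s\<^sup>2 * (\<Sum>t\<in>I. T2 t)" for s
  proof -
    let ?H = "\<lambda>j. off_diag n (K s j)" and ?f = "stack n \<nu> (\<lambda>_. 0)"
    let ?\<sigma> = "assign_axh (direct_sum A A) (direct_sum X X) ?H"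
    have H: "?H \<in> sym_tuples (n + n)"
      using symmat_off_diag unfolding sym_tuples_def symmat_def by blast
    have AX2: "(direct_sum A A, direct_sum X X) \<in> W (n + n)"
      by (rule domain2_direct_sum[OF W n n AX AX])
    have nn: "n + n > 0" using n by simp
    have s2: "direct_sum A A \<in> sym_tuples (n + n)" "direct_sum X X \<in> sym_tuples (n + n)"
      using domain2_subset[OF W nn AX2] by simp_all
    note car = symmat_carrier[OF symmat_assign_axh[OF s2 H]]
    have "0 \<le> ip (n + n) ?f (mv (n + n) (nc_eval (n + n) ?\<sigma> (hessian_x p)) ?f)"
      using psd_ip[OF psd[OF nn AX2 H]] by (simp add: eval_axh_def)
    also have "\<dots> = (\<Sum>w\<in>two_h ` I. Poly_Mapping.lookup (hessian_x p) w * ip (n + n) ?f (word_act (n + n) ?\<sigma> w ?f))"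
      unfolding ip_nc_eval[OF car] img ..
    also have "\<dots> = (\<Sum>t\<in>I. Poly_Mapping.lookup (hessian_x p) (two_h t) * ip (n + n) ?f (word_act (n + n) ?\<sigma> (two_h t) ?f))"
      by (subst sum.reindex) (auto intro: inj_on_subset[OF inj_two_h])
    also have "\<dots> = (\<Sum>t\<in>I. T0 t + s * T1 t + s\<^sup>2 * T2 t)"
    proof (rule sum.cong[OF refl])
      fix t assume "t \<in> I"
      obtain a i b j c where t: "t = (a, i, b, j, c)" by (cases t)
      have m: "a \<in> F" "b \<in> F" "c \<in> F" using I_F \<open>t \<in> I\<close> t by blast+
      have "ip (n + n) ?f (word_act (n + n) ?\<sigma> (two_h t) ?f)
          = ip n (\<lambda>l. P i a * \<nu> l + (s * Q i a) * \<beta> b0 l) (?act b (\<lambda>l. P j c * \<nu> l + (s * Q j c) * \<beta> b0 l))"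
        unfolding t two_h_at_doubled_point[OF A X] K[OF m(1)] K[OF m(3)] ..
      also have "\<dots> = P i a * (P j c * ip n \<nu> (?act b \<nu>) + (s * Q j c) * ip n \<nu> (?act b (\<beta> b0)))
          + (s * Q i a) * (P j c * ip n (\<beta> b0) (?act b \<nu>) + (s * Q j c) * ip n (\<beta> b0) (?act b (\<beta> b0)))"
        unfolding word_act_linear ip_linear
        unfolding ip_commute[of n "\<lambda>l. P i a * \<nu> l + (s * Q i a) * \<beta> b0 l"] ip_linear
        unfolding ip_commute[of n "?act b _"]
        by (simp add: algebra_simps)
      finally show "Poly_Mapping.lookup (hessian_x p) (two_h t) * ip (n + n) ?f (word_act (n + n) ?\<sigma> (two_h t) ?f)
          = T0 t + s * T1 t + s\<^sup>2 * T2 t"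
        unfolding t look T0_def T1_def T2_def
        by (simp add: algebra_simps power2_eq_square)
    qed
    finally show ?thesis by (simp add: sum.distrib sum_distrib_left)
  qed

  \<comment> \<open>The only candidates are the words \<open>v0\<^sup>T x b x v0\<close>, of degree at least \<open>2 d\<^sub>x - 2 > d\<^sub>x\<close> in \<open>x\<close>.\<close>
  have T0: "T0 t = 0" for t
  proof -
    obtain a i b j c where t: "t = (a, i, b, j, c)" by (cases t)
    have "?P (rev v0 @ Xvar j0 # b @ Xvar j0 # v0) = 0"
    proof (rule ccontr)
      assume "?P (rev v0 @ Xvar j0 # b @ Xvar j0 # v0) \<noteq> 0"
      from keys_deg[OF this] show False using split(4) deg by (simp flip: rev_filter)
    qed
    then show ?thesis by (auto simp: t T0_def P_def)
  qed
  \<comment> \<open>The linear terms come from \<open>\<alpha>\<close> and from its reversal, which has the same coefficient by symmetry of \<open>p\<close>.\<close>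
  define t1 t2 where "t1 = (u0, i0, b0, j0, v0)" and "t2 = (v0, j0, rev b0, i0, u0)"
  have Pt: "?P (rev u0 @ Xvar i0 # b0 @ Xvar j0 # v0) = ?P \<alpha>"
    "?P (rev v0 @ Xvar j0 # rev b0 @ Xvar i0 # u0) = ?P \<alpha>"
    using lookup_rev[OF sym, of \<alpha>] by (simp_all add: split(1) u0_def)
  have T1: "T1 t = (if t = t1 then 2 * ?P \<alpha> else 0) + (if t = t2 then 2 * ?P \<alpha> else 0)" if "t \<in> I" for t
  proof -
    obtain a i b j c where t: "t = (a, i, b, j, c)" by (cases t)
    have m: "b \<in> F" using I_F that t by blast
    have r: "rev b \<in> F" using m by (simp add: F_def flip: rev_filter)
    have 1: "ip n (\<beta> b0) (?act b \<nu>) = (if b = b0 then 1 else 0)" using dual m inF by blast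
    have "ip n \<nu> (?act b (\<beta> b0)) = ip n (?act (rev b) \<nu>) (\<beta> b0)"
      by (simp add: ip_word_act_rev[OF symmat_assign_ax[OF A X]])
    also have "\<dots> = (if rev b = b0 then 1 else 0)" using dual r inF by (subst ip_commute) blast
    finally have 2: "ip n \<nu> (?act b (\<beta> b0)) = (if b = rev b0 then 1 else 0)" by auto
    show ?thesis
      unfolding t T1_def t1_def t2_def prod.case 1 2
      using u0v0 Pt by (auto simp: P_def Q_def)
  qed
  have "t1 \<in> I" "t2 \<in> I"
    using \<alpha>(1) Pt by (simp_all add: I_def t1_def t2_def in_keys_iff look)
  have "(\<Sum>t\<in>I. T1 t) = (\<Sum>t\<in>I. (if t = t1 then 2 * ?P \<alpha> else 0) + (if t = t2 then 2 * ?P \<alpha> else 0))"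
    by (intro sum.cong refl T1)
  also have "\<dots> = 4 * ?P \<alpha>"
    using finI \<open>t1 \<in> I\<close> \<open>t2 \<in> I\<close> by (simp add: sum.distrib)
  finally have S1: "(\<Sum>t\<in>I. T1 t) = 4 * ?P \<alpha>" .
  have "4 * ?P \<alpha> = 0"
    by (rule linear_coeff_zero[of _ "\<Sum>t\<in>I. T2 t"]) (use form T0 S1 in simp)
  with \<alpha>(1) show False by simp
qed

section \<open>Degree two in x: convexity\<close>

definition x2_part :: "'g axvar ncpoly \<Rightarrow> 'g axvar ncpoly" where
  "x2_part p = poly_on {w \<in> Poly_Mapping.keys p. length (filter is_Xvar w) = 2} (Poly_Mapping.lookup p)"

lemma lookup_x2_part:
  "Poly_Mapping.lookup (x2_part p) w = (if length (filter is_Xvar w) = 2 then Poly_Mapping.lookup p w else 0)"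
  by (simp add: x2_part_def lookup_poly_on in_keys_iff)

lemma keys_x2_part: "Poly_Mapping.keys (x2_part p) = {w \<in> Poly_Mapping.keys p. length (filter is_Xvar w) = 2}"
  by (auto simp: in_keys_iff lookup_x2_part split: if_splits)

fun x_to_h :: "'g axvar \<Rightarrow> 'g axhvar" where
  "x_to_h (Avar j) = AXvar (Avar j)"
| "x_to_h (Xvar j) = Hvar j"

lemma forget_x_to_h: "map (\<lambda>v. forget_h (x_to_h v)) w = w"
proof (induction w)
  case (Cons v w)
  then show ?case by (cases v) auto
qed simp

lemma is_h_x_to_h [simp]: "is_h (x_to_h v) = is_Xvar v"
  by (cases v) simp_all

lemma h_count_x_to_h: "h_count (map x_to_h w) = length (filter is_Xvar w)"
proof (induction w)
  case (Cons v w)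
  then show ?case by (cases v) auto
qed simp

lemma h_count_le: "h_count W \<le> length (filter is_Xvar (map forget_h W))"
proof (induction W)
  case (Cons v W)
  then show ?case by (cases v) auto
qed simp

lemma h_count_eq:
  "h_count W = length (filter is_Xvar (map forget_h W)) \<Longrightarrow> W = map x_to_h (map forget_h W)"
proof (induction W)
  case (Cons v W)
  show ?case
  proof (cases v)
    case (AXvar u)
    then show ?thesis using Cons h_count_le[of W] by (cases u) auto
  next
    case (Hvar j)
    then show ?thesis using Cons by auto
  qed
qed simp

text \<open>
  With at most two letters \<open>x\<close> in each word of \<open>p\<close>, both must turn into \<open>h\<close>: no \<open>x\<close> is left in the
  Hessian.
\<close>

lemma keys_hessian_x_quadratic:
  assumes "degree_x p \<le> 2"
  shows "Poly_Mapping.keys (hessian_x p) = map x_to_h ` Poly_Mapping.keys (x2_part p)"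
proof (intro equalityI subsetI)
  fix W assume "W \<in> Poly_Mapping.keys (hessian_x p)"
  then have W: "h_count W = 2" "map forget_h W \<in> Poly_Mapping.keys p"
    by (auto simp: in_keys_iff lookup_hessian_x split: if_splits)
  then have "length (filter is_Xvar (map forget_h W)) = 2"
    using assms h_count_le[of W] unfolding degree_in_le by (metis le_antisym)
  then show "W \<in> map x_to_h ` Poly_Mapping.keys (x2_part p)"
    using W h_count_eq[of W] unfolding keys_x2_part by (metis (mono_tags, lifting) imageI mem_Collect_eq)
next
  fix W assume "W \<in> map x_to_h ` Poly_Mapping.keys (x2_part p)"
  then obtain w where w: "W = map x_to_h w" "w \<in> Poly_Mapping.keys p" "length (filter is_Xvar w) = 2"
    unfolding keys_x2_part by auto
  then show "W \<in> Poly_Mapping.keys (hessian_x p)"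
    by (simp add: in_keys_iff lookup_hessian_x h_count_x_to_h comp_def forget_x_to_h)
qed

lemma eval_word_map: "eval_word n \<sigma> (map f w) = eval_word n (\<lambda>v. \<sigma> (f v)) w"
  by (induction w) simp_all

lemma assign_axh_x_to_h: "assign_axh A X H (x_to_h v) = assign_ax A H v"
  by (cases v) simp_all

lemma eval_hessian_x_quadratic:
  assumes "degree_x p \<le> 2"
  shows "eval_axh n (hessian_x p) A X H = 2 \<cdot>\<^sub>m eval_ax n (x2_part p) A H"
proof -
  have "inj_on (map x_to_h) S" for S :: "'a axvar list set"
    by (rule inj_on_inverseI[of _ "map forget_h"]) (simp add: comp_def forget_x_to_h)
  then have "(\<Sum>W\<in>Poly_Mapping.keys (hessian_x p). Poly_Mapping.lookup (hessian_x p) W * eval_word n (assign_axh A X H) W $$ (i, j))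
      = (\<Sum>w\<in>Poly_Mapping.keys (x2_part p). 2 * (Poly_Mapping.lookup (x2_part p) w * eval_word n (assign_ax A H) w $$ (i, j)))" for i j
    unfolding keys_hessian_x_quadratic[OF assms]
    by (subst sum.reindex) (auto simp: lookup_hessian_x lookup_x2_part h_count_x_to_h comp_def forget_x_to_h
        eval_word_map assign_axh_x_to_h keys_x2_part intro!: sum.cong)
  then show ?thesis
    by (intro eq_matI) (simp_all add: eval_axh_def eval_ax_def nc_eval_def sum_distrib_left)
qed

lemma eval_word_degree_0:
  "filter is_Xvar w = [] \<Longrightarrow> eval_word n (assign_ax A X) w = eval_word n (assign_ax A Y) w"
proof (induction w)
  case (Cons v w)
  then show ?case by (cases v) auto
qed simp

lemma sym_tuples_carrier:
  "A \<in> sym_tuples n \<Longrightarrow> X \<in> sym_tuples n \<Longrightarrow> assign_ax A X v \<in> carrier_mat n n"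
  using symmat_assign_ax symmat_carrier by blast

lemma eval_word_degree_1:
  assumes A: "A \<in> sym_tuples n" and X: "X \<in> sym_tuples n" and Y: "Y \<in> sym_tuples n" and Z: "Z \<in> sym_tuples n"
    and lin: "\<And>l i k. i < n \<Longrightarrow> k < n \<Longrightarrow> Z l $$ (i, k) = s * X l $$ (i, k) + t * Y l $$ (i, k)"
    and "length (filter is_Xvar w) = 1" "i < n" "j < n"
  shows "eval_word n (assign_ax A Z) w $$ (i, j)
    = s * eval_word n (assign_ax A X) w $$ (i, j) + t * eval_word n (assign_ax A Y) w $$ (i, j)"
  using assms(6,7)
proof (induction w arbitrary: i)
  case (Cons v w)
  note E = eval_word_Cons_entry[OF sym_tuples_carrier[OF A X] Cons.prems(2) \<open>j < n\<close>]
    eval_word_Cons_entry[OF sym_tuples_carrier[OF A Y] Cons.prems(2) \<open>j < n\<close>]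
    eval_word_Cons_entry[OF sym_tuples_carrier[OF A Z] Cons.prems(2) \<open>j < n\<close>]
  show ?case
  proof (cases v)
    case (Avar l)
    then have "length (filter is_Xvar w) = 1" using Cons.prems(1) by simp
    from Cons.IH[OF this] show ?thesis
      unfolding E Avar assign_ax.simps sum_distrib_left sum.distrib[symmetric]
      by (intro sum.cong refl) (simp add: algebra_simps)
  next
    case (Xvar l)
    then have "filter is_Xvar w = []" using Cons.prems(1) by simp
    note e = eval_word_degree_0[OF this, of n A _ X]
    show ?thesis
      unfolding E Xvar assign_ax.simps sum_distrib_left sum.distrib[symmetric] e[of Y] e[of Z]
      using Cons.prems(2) by (intro sum.cong refl) (simp add: lin algebra_simps)
  qed
qed simp

lemma scaled_identity:
  fixes t x y z d a :: real
  assumes "t * x + (1 - t) * y - z = t * (1 - t) * d"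
  shows "t * (a * x) + (1 - t) * (a * y) - a * z = t * (1 - t) * (a * d)"
  using arg_cong[OF assms, of "\<lambda>u. a * u"] by (simp add: algebra_simps)

text \<open>
  For a quadratic map \<open>Q\<close>, \<open>t Q(X) + (1 - t) Q(Y) - Q(t X + (1 - t) Y) = t (1 - t) Q(X - Y)\<close>.
\<close>

lemma eval_word_degree_2:
  assumes A: "A \<in> sym_tuples n" and X: "X \<in> sym_tuples n" and Y: "Y \<in> sym_tuples n" and Z: "Z \<in> sym_tuples n"
    and D: "D \<in> sym_tuples n"
    and Z_lin: "\<And>l i k. i < n \<Longrightarrow> k < n \<Longrightarrow> Z l $$ (i, k) = t * X l $$ (i, k) + (1 - t) * Y l $$ (i, k)"
    and D_lin: "\<And>l i k. i < n \<Longrightarrow> k < n \<Longrightarrow> D l $$ (i, k) = 1 * X l $$ (i, k) + (- 1) * Y l $$ (i, k)"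
    and "length (filter is_Xvar w) = 2" "i < n" "j < n"
  shows "t * eval_word n (assign_ax A X) w $$ (i, j) + (1 - t) * eval_word n (assign_ax A Y) w $$ (i, j)
      - eval_word n (assign_ax A Z) w $$ (i, j) = t * (1 - t) * eval_word n (assign_ax A D) w $$ (i, j)"
  using assms(8,9)
proof (induction w arbitrary: i)
  case (Cons v w)
  note E = eval_word_Cons_entry[OF sym_tuples_carrier[OF A X] Cons.prems(2) \<open>j < n\<close>]
    eval_word_Cons_entry[OF sym_tuples_carrier[OF A Y] Cons.prems(2) \<open>j < n\<close>]
    eval_word_Cons_entry[OF sym_tuples_carrier[OF A Z] Cons.prems(2) \<open>j < n\<close>]
    eval_word_Cons_entry[OF sym_tuples_carrier[OF A D] Cons.prems(2) \<open>j < n\<close>]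
  show ?case
  proof (cases v)
    case (Avar l)
    then have "length (filter is_Xvar w) = 2" using Cons.prems(1) by simp
    note IH = Cons.IH[OF this]
    show ?thesis
      unfolding E Avar assign_ax.simps sum_distrib_left sum.distrib[symmetric] sum_subtractf[symmetric]
    proof (intro sum.cong refl)
      fix k assume "k \<in> {..<n}"
      then have "k < n" by simp
      from IH[OF this] show "t * (A l $$ (i, k) * eval_word n (assign_ax A X) w $$ (k, j)) +
          (1 - t) * (A l $$ (i, k) * eval_word n (assign_ax A Y) w $$ (k, j)) -
          A l $$ (i, k) * eval_word n (assign_ax A Z) w $$ (k, j) =
          t * (1 - t) * (A l $$ (i, k) * eval_word n (assign_ax A D) w $$ (k, j))"
        by (rule scaled_identity)
    qed
  next
    case (Xvar l)
    then have "length (filter is_Xvar w) = 1" using Cons.prems(1) by simp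
    note IH = eval_word_degree_1[OF A X Y Z Z_lin this _ \<open>j < n\<close>] eval_word_degree_1[OF A X Y D D_lin this _ \<open>j < n\<close>]
    show ?thesis
      unfolding E Xvar assign_ax.simps sum_distrib_left sum.distrib[symmetric] sum_subtractf[symmetric]
    proof (intro sum.cong refl)
      fix k assume "k \<in> {..<n}"
      then have k: "k < n" by simp
      show "t * (X l $$ (i, k) * eval_word n (assign_ax A X) w $$ (k, j)) +
          (1 - t) * (Y l $$ (i, k) * eval_word n (assign_ax A Y) w $$ (k, j)) -
          Z l $$ (i, k) * eval_word n (assign_ax A Z) w $$ (k, j) =
          t * (1 - t) * (D l $$ (i, k) * eval_word n (assign_ax A D) w $$ (k, j))"
        using Cons.prems(2) k by (simp add: IH Z_lin D_lin algebra_simps)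
    qed
  qed
qed simp

lemma psd_smult: "psd n P \<Longrightarrow> 0 \<le> c \<Longrightarrow> psd n (c \<cdot>\<^sub>m P)"
proof -
  assume P: "psd n P" and c: "0 \<le> c"
  have "v \<bullet> ((c \<cdot>\<^sub>m P) *\<^sub>v v) = c * (v \<bullet> (P *\<^sub>v v))" if "v \<in> carrier_vec n" for v
  proof -
    have "P \<in> carrier_mat n n" using P by (simp add: psd_def)
    then have "(c \<cdot>\<^sub>m P) *\<^sub>v v = c \<cdot>\<^sub>v (P *\<^sub>v v)" "P *\<^sub>v v \<in> carrier_vec n"
      using that by (auto intro!: eq_vecI)
    then show ?thesis using that by simp
  qed
  moreover have "transpose_mat (c \<cdot>\<^sub>m P) = c \<cdot>\<^sub>m transpose_mat P" by (intro eq_matI) auto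
  ultimately show ?thesis using P c by (simp add: psd_def)
qed

lemma globally_convex_quadratic:
  assumes deg: "degree_x p \<le> 2" and A: "A \<in> sym_tuples n"
    and psd: "\<And>H. H \<in> sym_tuples n \<Longrightarrow> psd n (eval_ax n (x2_part p) A H)"
  shows "globally_convex n (\<lambda>X. eval_ax n p A X)"
  unfolding globally_convex_def
proof (intro ballI allI impI)
  fix X Y :: "'a mtuple" and t :: real
  assume X: "X \<in> sym_tuples n" and Y: "Y \<in> sym_tuples n" and t: "0 < t \<and> t < 1"
  define Z where "Z = (\<lambda>j. t \<cdot>\<^sub>m X j + (1 - t) \<cdot>\<^sub>m Y j)"
  define D where "D = (\<lambda>j. X j - Y j)"
  have car: "X l \<in> carrier_mat n n" "Y l \<in> carrier_mat n n"
    "transpose_mat (X l) = X l" "transpose_mat (Y l) = Y l" for l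
    using X Y by (auto simp: sym_tuples_def)
  have s: "X l $$ (i, k) = X l $$ (k, i)" "Y l $$ (i, k) = Y l $$ (k, i)" if "i < n" "k < n" for l i k
    using car[of l] that by (metis carrier_matD index_transpose_mat(1))+
  have Z: "Z \<in> sym_tuples n" "\<And>l i k. i < n \<Longrightarrow> k < n \<Longrightarrow> Z l $$ (i, k) = t * X l $$ (i, k) + (1 - t) * Y l $$ (i, k)"
  proof -
    show "Z \<in> sym_tuples n"
      unfolding sym_tuples_def Z_def using car(1,2) s carrier_matD[OF car(1)] carrier_matD[OF car(2)]
      by (auto intro!: eq_matI)
  qed (use carrier_matD[OF car(1)] carrier_matD[OF car(2)] in \<open>simp add: Z_def\<close>)
  have D: "D \<in> sym_tuples n" "\<And>l i k. i < n \<Longrightarrow> k < n \<Longrightarrow> D l $$ (i, k) = 1 * X l $$ (i, k) + (- 1) * Y l $$ (i, k)"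
  proof -
    show "D \<in> sym_tuples n"
      unfolding sym_tuples_def D_def using car(1,2) s carrier_matD[OF car(1)] carrier_matD[OF car(2)]
      by (auto intro!: eq_matI)
  qed (use carrier_matD[OF car(1)] carrier_matD[OF car(2)] in \<open>simp add: D_def\<close>)
  let ?E = "\<lambda>U w i j. eval_word n (assign_ax A U) w $$ (i, j)"
  have word: "t * ?E X w i j + (1 - t) * ?E Y w i j - ?E Z w i j
      = (if length (filter is_Xvar w) = 2 then t * (1 - t) * ?E D w i j else 0)"
    if "w \<in> Poly_Mapping.keys p" "i < n" "j < n" for w i j
  proof -
    have "length (filter is_Xvar w) \<le> 2" using deg that(1) by (simp add: degree_in_le)
    then consider "filter is_Xvar w = []" | "length (filter is_Xvar w) = 1" | "length (filter is_Xvar w) = 2"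
      by (metis One_nat_def Suc_1 le_Suc_eq le_zero_eq length_0_conv)
    then show ?thesis
    proof cases
      case 1
      then show ?thesis using eval_word_degree_0[OF 1, of n A Y X] eval_word_degree_0[OF 1, of n A Z X]
        by (simp add: algebra_simps)
    next
      case 2
      then show ?thesis using eval_word_degree_1[OF A X Y Z 2 that(2,3)] by simp
    next
      case 3
      then show ?thesis using eval_word_degree_2[OF A X Y Z(1) D(1) Z(2) D(2) 3 that(2,3)] by simp
    qed
  qed
  have "t \<cdot>\<^sub>m eval_ax n p A X + (1 - t) \<cdot>\<^sub>m eval_ax n p A Y - eval_ax n p A Z
      = (t * (1 - t)) \<cdot>\<^sub>m eval_ax n (x2_part p) A D" (is "?L = ?R")
  proof (rule eq_matI)
    fix i j assume "i < dim_row ?R" "j < dim_col ?R"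
    then have ij: "i < n" "j < n" by (simp_all add: eval_ax_def nc_eval_def)
    have "?L $$ (i, j) = (\<Sum>w\<in>Poly_Mapping.keys p. Poly_Mapping.lookup p w *
        (t * ?E X w i j + (1 - t) * ?E Y w i j - ?E Z w i j))"
      using ij by (simp add: eval_ax_def nc_eval_def sum_distrib_left sum.distrib sum_subtractf algebra_simps)
    also have "\<dots> = (\<Sum>w\<in>Poly_Mapping.keys p. if length (filter is_Xvar w) = 2
        then t * (1 - t) * (Poly_Mapping.lookup p w * ?E D w i j) else 0)"
      using ij by (intro sum.cong refl) (simp add: word)
    also have "\<dots> = (\<Sum>w\<in>Poly_Mapping.keys (x2_part p). t * (1 - t) * (Poly_Mapping.lookup (x2_part p) w * ?E D w i j))"
      unfolding keys_x2_part by (simp add: sum.inter_filter lookup_x2_part)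
    also have "\<dots> = ?R $$ (i, j)"
      using ij by (simp add: eval_ax_def nc_eval_def sum_distrib_left)
    finally show "?L $$ (i, j) = ?R $$ (i, j)" .
  qed (simp_all add: eval_ax_def nc_eval_def)
  moreover have "psd n ?R" using psd[OF D(1)] t by (intro psd_smult) simp_all
  ultimately show "psd n (t \<cdot>\<^sub>m eval_ax n p A X + (1 - t) \<cdot>\<^sub>m eval_ax n p A Y
      - eval_ax n p A (\<lambda>j. t \<cdot>\<^sub>m X j + (1 - t) \<cdot>\<^sub>m Y j))"
    by (simp add: Z_def)
qed

section \<open>Positive semidefinite kernels\<close>

definition quad_form :: "'w set \<Rightarrow> ('w \<Rightarrow> 'w \<Rightarrow> real) \<Rightarrow> ('w \<Rightarrow> real) \<Rightarrow> real" where
  "quad_form B G c = (\<Sum>u\<in>B. \<Sum>v\<in>B. c u * c v * G u v)"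

definition psd_kernel :: "'w set \<Rightarrow> ('w \<Rightarrow> 'w \<Rightarrow> real) \<Rightarrow> bool" where
  "psd_kernel B G \<longleftrightarrow> (\<forall>u\<in>B. \<forall>v\<in>B. G u v = G v u) \<and> (\<forall>c. 0 \<le> quad_form B G c)"

lemma quad_form_insert:
  assumes "finite B" "x \<notin> B" "\<forall>u\<in>insert x B. \<forall>v\<in>insert x B. G u v = G v u"
  shows "quad_form (insert x B) G c = (c x)\<^sup>2 * G x x + 2 * c x * (\<Sum>v\<in>B. c v * G x v) + quad_form B G c"
proof -
  have "(\<Sum>u\<in>B. c u * c x * G u x) = c x * (\<Sum>v\<in>B. c v * G x v)"
    unfolding sum_distrib_left
  proof (intro sum.cong refl)
    fix u assume "u \<in> B"
    then have "G u x = G x u" using assms(3) by blast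
    then show "c u * c x * G u x = c x * (c u * G x u)" by simp
  qed
  moreover have "(\<Sum>v\<in>B. c x * c v * G x v) = c x * (\<Sum>v\<in>B. c v * G x v)"
    unfolding sum_distrib_left by (intro sum.cong refl) simp
  moreover have "quad_form (insert x B) G c = c x * c x * G x x + (\<Sum>v\<in>B. c x * c v * G x v)
      + ((\<Sum>u\<in>B. c u * c x * G u x) + quad_form B G c)"
    using assms(1,2) by (simp add: quad_form_def sum.distrib)
  ultimately show ?thesis by (simp only: power2_eq_square)
qed

text \<open>
  A Cholesky factorisation, one point \<open>x\<close> at a time: the row of \<open>x\<close> divided by \<open>sqrt (G x x)\<close> is one
  factor, and the Schur complement is again positive semidefinite.
\<close>

lemma psd_kernel_factor:
  assumes "finite B" "psd_kernel B G"
  shows "\<exists>r. \<forall>u\<in>B. \<forall>v\<in>B. G u v = (\<Sum>k\<in>B. r k u * r k v)"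
  using assms
proof (induction B arbitrary: G)
  case (insert x B)
  have sym: "\<forall>u\<in>insert x B. \<forall>v\<in>insert x B. G u v = G v u" and pos: "\<And>c. 0 \<le> quad_form (insert x B) G c"
    using insert.prems unfolding psd_kernel_def by blast+
  note qi = quad_form_insert[OF insert.hyps(1,2) sym]
  have quad_upd: "quad_form B G (c(x := a)) = quad_form B G c" "(\<Sum>v\<in>B. (c(x := a)) v * G x v) = (\<Sum>v\<in>B. c v * G x v)" for c a
    using insert.hyps(2) by (auto simp: quad_form_def intro!: sum.cong)
  have Gxx: "0 \<le> G x x"
    using pos[of "\<lambda>v. if v = x then 1 else 0"] qi[of "\<lambda>v. if v = x then 1 else 0"] insert.hyps
    by (auto simp: quad_form_def sum.neutral)
  have row_zero: "G x v = 0" if "G x x = 0" "v \<in> B" for v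
  proof -
    define e where "e w = (if w = v then 1 else 0 :: real)" for w
    have ev: "(\<Sum>w\<in>B. e w * G x w) = G x v"
      using that(2) insert.hyps(1) by (simp add: e_def if_distrib[of "\<lambda>z. z * _"] cong: if_cong)
    have "0 \<le> s * (2 * G x v) + quad_form B G e" for s
      using pos[of "e(x := s)"] qi[of "e(x := s)"] quad_upd[of e s] that(1) ev by (simp add: mult_ac)
    from this[of "- (quad_form B G e + 1) / (2 * G x v)"] show ?thesis by (cases "G x v = 0") auto
  qed
  \<comment> \<open>If \<open>G x x = 0\<close>, the whole row of \<open>x\<close> is zero, and the quotients are zero by the convention for division.\<close>
  define G' where "G' u v = G u v - G x u * G x v / G x x" for u v
  have "psd_kernel B G'"
    unfolding psd_kernel_def
  proof (intro conjI ballI allI)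
    fix u v assume "u \<in> B" "v \<in> B"
    then have "G u v = G v u" using sym by blast
    then show "G' u v = G' v u" by (simp add: G'_def)
  next
    fix c
    define s where "s = (\<Sum>v\<in>B. c v * G x v)"
    have "(\<Sum>u\<in>B. \<Sum>v\<in>B. c u * c v * (G x u * G x v / G x x)) = s * s / G x x"
      unfolding s_def sum_product sum_divide_distrib by (intro sum.cong refl) (simp add: mult_ac)
    then have q': "quad_form B G' c = quad_form B G c - s * s / G x x"
      by (simp add: quad_form_def G'_def algebra_simps sum_subtractf)
    have "quad_form (insert x B) G (c(x := - s / G x x)) = quad_form B G c - s * s / G x x"
      unfolding qi quad_upd s_def[symmetric] by (cases "G x x = 0") (simp_all add: field_simps power2_eq_square)
    then show "0 \<le> quad_form B G' c" using pos q' by metis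
  qed
  from insert.IH[OF this] obtain r where r: "\<forall>u\<in>B. \<forall>v\<in>B. G' u v = (\<Sum>k\<in>B. r k u * r k v)" ..
  define r' where "r' k u = (if k = x then G x u / sqrt (G x x) else if u = x then 0 else r k u)" for k u
  have xx: "r' x u * r' x v = G x u * G x v / G x x" for u v
    using Gxx by (simp add: r'_def)
  have "G u v = (\<Sum>k\<in>insert x B. r' k u * r' k v)" if uv: "u \<in> insert x B" "v \<in> insert x B" for u v
  proof -
    have "(\<Sum>k\<in>insert x B. r' k u * r' k v) = G x u * G x v / G x x + (\<Sum>k\<in>B. r' k u * r' k v)"
      using insert.hyps by (simp add: xx)
    also have "(\<Sum>k\<in>B. r' k u * r' k v) = (if u = x \<or> v = x then 0 else G' u v)"
    proof (cases "u = x \<or> v = x")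
      case True
      then show ?thesis using insert.hyps by (auto simp: r'_def intro!: sum.neutral)
    next
      case False
      then have "(\<Sum>k\<in>B. r' k u * r' k v) = (\<Sum>k\<in>B. r k u * r k v)"
        using insert.hyps by (intro sum.cong) (auto simp: r'_def)
      then show ?thesis using r uv False by auto
    qed
    also have "G x u * G x v / G x x + (if u = x \<or> v = x then 0 else G' u v) = G u v"
    proof (cases "G x x = 0")
      case True
      then have "G x w = 0" if "w \<in> insert x B" for w using row_zero that by auto
      moreover from this have "G w x = 0" if "w \<in> insert x B" for w using that sym by (metis insertI1)
      ultimately show ?thesis using uv by (auto simp: G'_def)
    next
      case False
      have "G u x = G x u" using sym uv by blast
      then show ?thesis using False by (auto simp: G'_def)
    qed
    finally show ?thesis ..
  qed
  then show ?case by blast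
qed simp

text \<open>
  The kernel of the form \<open>(f, g) \<mapsto> \<phi> (f\<^sup>T g)\<close> on polynomials, where \<open>\<phi>\<close> is a linear functional given
  by its values on words.
\<close>

definition hankel :: "('v list \<Rightarrow> real) \<Rightarrow> 'v list \<Rightarrow> 'v list \<Rightarrow> real" where
  "hankel \<phi> u v = \<phi> (rev u @ v)"

text \<open>
  A strictly positive functional. Distinct words \<open>u\<close> and \<open>v\<close> of equal length are orthogonal, since
  \<open>rev u @ v\<close> is then no palindrome, and for different lengths the strict convexity of the square
  makes the entry at \<open>(u, v)\<close> smaller, by a factor \<open>\<theta>\<close> or more, than the geometric mean of the
  corresponding diagonal entries.
\<close>

definition palindrome_weight :: "real \<Rightarrow> 'v list \<Rightarrow> real" where
  "palindrome_weight \<theta> w = (if rev w = w then \<theta> ^ (length w)\<^sup>2 else 0)"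

lemma palindrome_weight_rev: "palindrome_weight \<theta> (rev w) = palindrome_weight \<theta> w"
  by (auto simp: palindrome_weight_def)

lemma palindrome_weight_off_diagonal:
  assumes "\<theta> \<ge> 1" "u \<noteq> v"
  shows "\<theta> * hankel (palindrome_weight \<theta>) u v \<le> \<theta> ^ (2 * (length u)\<^sup>2) * \<theta> ^ (2 * (length v)\<^sup>2)"
    "0 \<le> hankel (palindrome_weight \<theta>) u v"
proof -
  show "0 \<le> hankel (palindrome_weight \<theta>) u v" using assms by (simp add: hankel_def palindrome_weight_def)
  show "\<theta> * hankel (palindrome_weight \<theta>) u v \<le> \<theta> ^ (2 * (length u)\<^sup>2) * \<theta> ^ (2 * (length v)\<^sup>2)"
  proof (cases "length u = length v")
    case True
    then have "rev (rev u @ v) \<noteq> rev u @ v" using assms(2) by simp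
    then show ?thesis using assms(1) by (simp add: hankel_def palindrome_weight_def)
  next
    case False
    have "int (length u) - int (length v) \<noteq> 0" using False by simp
    then have "(int (length u) - int (length v))\<^sup>2 > 0" by simp
    then have "1 + (int (length u) + int (length v))\<^sup>2 \<le> 2 * (int (length u))\<^sup>2 + 2 * (int (length v))\<^sup>2"
      by (simp add: power2_eq_square algebra_simps)
    then have "int (Suc ((length u + length v)\<^sup>2)) \<le> int (2 * (length u)\<^sup>2 + 2 * (length v)\<^sup>2)"
      by simp
    then have "Suc ((length u + length v)\<^sup>2) \<le> 2 * (length u)\<^sup>2 + 2 * (length v)\<^sup>2"
      by (simp only: of_nat_le_iff)
    then have "\<theta> ^ Suc ((length u + length v)\<^sup>2) \<le> \<theta> ^ (2 * (length u)\<^sup>2 + 2 * (length v)\<^sup>2)"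
      using assms(1) by (rule power_increasing)
    then show ?thesis using assms(1) by (auto simp: hankel_def palindrome_weight_def power_add)
  qed
qed

lemma palindrome_weight_diagonal: "hankel (palindrome_weight \<theta>) u u = (\<theta> ^ (2 * (length u)\<^sup>2))\<^sup>2"
proof -
  have "(length u + length u)\<^sup>2 = 2 * (2 * (length u)\<^sup>2)" by (simp add: power2_eq_square algebra_simps)
  then show ?thesis by (simp add: hankel_def palindrome_weight_def power_mult[symmetric] mult.commute)
qed

text \<open>
  Diagonal dominance after rescaling by the square roots \<open>\<theta> ^ (2 * (length u)\<^sup>2)\<close> of the diagonal:
  the off-diagonal entries are at most \<open>1 / \<theta>\<close>, and a row has \<open>card B = \<theta> / 2\<close> entries.
\<close>

lemma palindrome_weight_hankel_coercive:
  assumes "finite B" "B \<noteq> {}" and \<theta>: "\<theta> = 2 * real (card B)"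
  shows "(\<Sum>u\<in>B. (c u)\<^sup>2) / 2 \<le> quad_form B (hankel (palindrome_weight \<theta>)) c"
proof -
  have N: "card B \<ge> 1" using assms by (simp add: Suc_leI card_gt_0_iff)
  then have \<theta>1: "\<theta> \<ge> 1" and \<theta>0: "\<theta> > 0" using \<theta> by auto
  define e where "e u = \<bar>c u\<bar> * \<theta> ^ (2 * (length u)\<^sup>2)" for u
  let ?H = "hankel (palindrome_weight \<theta>)"
  have off: "c u * c v * ?H u v \<ge> - (((e u)\<^sup>2 + (e v)\<^sup>2) / (2 * \<theta>))" if "u \<noteq> v" for u v
  proof -
    have "?H u v \<le> \<theta> ^ (2 * (length u)\<^sup>2) * \<theta> ^ (2 * (length v)\<^sup>2) / \<theta>"
      using palindrome_weight_off_diagonal(1)[OF \<theta>1 that] \<theta>0 by (simp add: pos_le_divide_eq mult.commute)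
    then have "\<bar>c u * c v\<bar> * ?H u v \<le> \<bar>c u * c v\<bar> * (\<theta> ^ (2 * (length u)\<^sup>2) * \<theta> ^ (2 * (length v)\<^sup>2) / \<theta>)"
      by (intro mult_left_mono) auto
    also have "\<dots> = e u * e v / \<theta>" by (simp add: e_def abs_mult)
    also have "\<dots> \<le> ((e u)\<^sup>2 + (e v)\<^sup>2) / (2 * \<theta>)"
      using sum_squares_bound[of "e u" "e v"] \<theta>0 by (simp add: field_simps)
    finally have "\<bar>c u * c v\<bar> * ?H u v \<le> ((e u)\<^sup>2 + (e v)\<^sup>2) / (2 * \<theta>)" .
    moreover have "- (\<bar>c u * c v\<bar> * ?H u v) \<le> c u * c v * ?H u v"
      using palindrome_weight_off_diagonal(2)[OF \<theta>1 that] by (simp add: mult_right_mono flip: mult_minus_left)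
    ultimately show ?thesis by linarith
  qed
  have diag: "c u * c u * ?H u u = (e u)\<^sup>2" for u
    unfolding palindrome_weight_diagonal e_def by (simp add: power2_eq_square mult_ac)
  have "(e u)\<^sup>2 - (\<Sum>v\<in>B. ((e u)\<^sup>2 + (e v)\<^sup>2) / (2 * \<theta>)) \<le> (\<Sum>v\<in>B. c u * c v * ?H u v)" if "u \<in> B" for u
  proof -
    have "(e u)\<^sup>2 - (\<Sum>v\<in>B. ((e u)\<^sup>2 + (e v)\<^sup>2) / (2 * \<theta>))
        = (\<Sum>v\<in>B. (if v = u then (e u)\<^sup>2 else 0) - ((e u)\<^sup>2 + (e v)\<^sup>2) / (2 * \<theta>))"
      using that assms(1) by (simp add: sum_subtractf)
    also have "\<dots> \<le> (\<Sum>v\<in>B. c u * c v * ?H u v)"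
    proof (rule sum_mono)
      fix v
      show "(if v = u then (e u)\<^sup>2 else 0) - ((e u)\<^sup>2 + (e v)\<^sup>2) / (2 * \<theta>) \<le> c u * c v * ?H u v"
        using off[of u v] diag[of u] \<theta>0 by auto
    qed
    finally show ?thesis .
  qed
  then have "(\<Sum>u\<in>B. (e u)\<^sup>2 - (\<Sum>v\<in>B. ((e u)\<^sup>2 + (e v)\<^sup>2) / (2 * \<theta>))) \<le> quad_form B ?H c"
    unfolding quad_form_def by (rule sum_mono)
  moreover have "(\<Sum>u\<in>B. (e u)\<^sup>2 - (\<Sum>v\<in>B. ((e u)\<^sup>2 + (e v)\<^sup>2) / (2 * \<theta>))) = (\<Sum>u\<in>B. (e u)\<^sup>2) / 2"
  proof -
    have "(\<Sum>u\<in>B. \<Sum>v\<in>B. ((e u)\<^sup>2 + (e v)\<^sup>2) / (2 * \<theta>)) = 2 * (card B * (\<Sum>u\<in>B. (e u)\<^sup>2)) / (2 * \<theta>)"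
      by (simp add: sum.distrib sum_divide_distrib[symmetric] sum_distrib_left[symmetric])
    also have "\<dots> = (\<Sum>u\<in>B. (e u)\<^sup>2) / 2" using N by (simp add: \<theta> field_simps)
    finally show ?thesis by (simp add: sum_subtractf)
  qed
  moreover have "(c u)\<^sup>2 \<le> (e u)\<^sup>2" for u
  proof -
    have "\<bar>c u\<bar> * 1 \<le> e u" unfolding e_def using \<theta>1 by (intro mult_left_mono) auto
    then show ?thesis by (metis abs_ge_zero mult.right_neutral power2_abs power_mono)
  qed
  then have "(\<Sum>u\<in>B. (c u)\<^sup>2) \<le> (\<Sum>u\<in>B. (e u)\<^sup>2)" by (rule sum_mono)
  ultimately show ?thesis by linarith
qed

section \<open>Gram kernels or a separating functional\<close>

text \<open>
  The coefficient of \<open>w\<close> in \<open>\<Sum> G u v u\<^sup>T v\<close>. A polynomial with these coefficients for a positive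
  semidefinite \<open>G\<close> is a sum of hermitian squares, by factoring \<open>G\<close>.
\<close>

definition gram_coeff :: "'v list set \<Rightarrow> ('v list \<Rightarrow> 'v list \<Rightarrow> real) \<Rightarrow> 'v list \<Rightarrow> real" where
  "gram_coeff B G w = (\<Sum>u\<in>B. \<Sum>v\<in>B. if rev u @ v = w then G u v else 0)"

definition products :: "'v list set \<Rightarrow> 'v list set" where
  "products B = (\<lambda>(u, v). rev u @ v) ` (B \<times> B)"

lemma finite_products: "finite B \<Longrightarrow> finite (products B)"
  by (simp add: products_def)

lemma productsI: "u \<in> B \<Longrightarrow> v \<in> B \<Longrightarrow> rev u @ v \<in> products B"
  unfolding products_def by force

lemma gram_coeff_outside: "w \<notin> products B \<Longrightarrow> gram_coeff B G w = 0"
  unfolding gram_coeff_def products_def by (intro sum.neutral ballI) force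

lemma sum_gram_coeff:
  assumes "finite B"
  shows "(\<Sum>w\<in>products B. e w * gram_coeff B G w) = (\<Sum>u\<in>B. \<Sum>v\<in>B. e (rev u @ v) * G u v)"
proof -
  have "(\<Sum>w\<in>products B. e w * gram_coeff B G w)
      = (\<Sum>w\<in>products B. \<Sum>u\<in>B. \<Sum>v\<in>B. if rev u @ v = w then e w * G u v else 0)"
    unfolding gram_coeff_def sum_distrib_left by (intro sum.cong refl) simp
  also have "\<dots> = (\<Sum>u\<in>B. \<Sum>w\<in>products B. \<Sum>v\<in>B. if rev u @ v = w then e w * G u v else 0)"
    by (rule sum.swap)
  also have "\<dots> = (\<Sum>u\<in>B. \<Sum>v\<in>B. \<Sum>w\<in>products B. if rev u @ v = w then e w * G u v else 0)"
    by (intro sum.cong refl sum.swap)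
  also have "\<dots> = (\<Sum>u\<in>B. \<Sum>v\<in>B. e (rev u @ v) * G u v)"
  proof (intro sum.cong refl)
    fix u v assume "u \<in> B" "v \<in> B"
    then have "rev u @ v \<in> products B" by (force simp: products_def)
    then show "(\<Sum>w\<in>products B. if rev u @ v = w then e w * G u v else 0) = e (rev u @ v) * G u v"
      using finite_products[OF assms] by simp
  qed
  finally show ?thesis .
qed

lemma gram_coeff_rev:
  assumes "\<forall>u\<in>B. \<forall>v\<in>B. G u v = G v u"
  shows "gram_coeff B G (rev w) = gram_coeff B G w"
proof -
  have "gram_coeff B G (rev w) = (\<Sum>v\<in>B. \<Sum>u\<in>B. if rev u @ v = rev w then G u v else 0)"
    unfolding gram_coeff_def by (rule sum.swap)
  also have "\<dots> = gram_coeff B G w"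
    unfolding gram_coeff_def
  proof (intro sum.cong refl)
    fix u v assume "v \<in> B" "u \<in> B"
    then have "G u v = G v u" using assms by blast
    moreover have "rev u @ v = rev w \<longleftrightarrow> rev v @ u = w"
      by (metis rev_append rev_rev_ident)
    ultimately show "(if rev u @ v = rev w then G u v else 0) = (if rev v @ u = w then G v u else 0)" by simp
  qed
  finally show ?thesis .
qed

lemma gram_coeff_linear:
  "gram_coeff B (\<lambda>u v. G u v + t * H u v) w = gram_coeff B G w + t * gram_coeff B H w"
  unfolding gram_coeff_def sum_distrib_left sum.distrib[symmetric]
  by (intro sum.cong refl) simp

lemma gram_coeff_cong:
  "(\<And>u v. u \<in> B \<Longrightarrow> v \<in> B \<Longrightarrow> G u v = H u v) \<Longrightarrow> gram_coeff B G w = gram_coeff B H w"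
  unfolding gram_coeff_def by (intro sum.cong refl) simp

lemma quad_form_cong:
  "(\<And>u v. u \<in> B \<Longrightarrow> v \<in> B \<Longrightarrow> G u v = H u v) \<Longrightarrow> quad_form B G c = quad_form B H c"
  unfolding quad_form_def by (intro sum.cong refl) simp

lemma psd_kernel_cong:
  "(\<And>u v. u \<in> B \<Longrightarrow> v \<in> B \<Longrightarrow> G u v = H u v) \<Longrightarrow> psd_kernel B G \<Longrightarrow> psd_kernel B H"
  unfolding psd_kernel_def using quad_form_cong[of B G H] by metis

lemma quad_form_linear: "quad_form B (\<lambda>u v. G u v + t * H u v) c = quad_form B G c + t * quad_form B H c"
  unfolding quad_form_def sum_distrib_left sum.distrib[symmetric]
  by (intro sum.cong refl) (simp add: algebra_simps)

lemma psd_kernel_add: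
  assumes "psd_kernel B G" "psd_kernel B H" "0 \<le> t"
  shows "psd_kernel B (\<lambda>u v. G u v + t * H u v)"
  unfolding psd_kernel_def
proof (intro conjI ballI allI)
  fix u v assume "u \<in> B" "v \<in> B"
  then have "G u v = G v u" "H u v = H v u" using assms unfolding psd_kernel_def by blast+
  then show "G u v + t * H u v = G v u + t * H v u" by simp
next
  fix c
  show "0 \<le> quad_form B (\<lambda>u v. G u v + t * H u v) c"
    using assms by (simp add: quad_form_linear psd_kernel_def)
qed

lemma psd_kernel_scale:
  assumes "psd_kernel B G" "0 \<le> t"
  shows "psd_kernel B (\<lambda>u v. t * G u v)"
proof -
  have "psd_kernel B (\<lambda>u v. 0)" by (simp add: psd_kernel_def quad_form_def)
  from psd_kernel_add[OF this assms] show ?thesis by simp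
qed

lemma psd_kernel_rank_one: "psd_kernel B (\<lambda>u v. c u * c v)"
  unfolding psd_kernel_def
proof (intro conjI ballI allI)
  fix d
  have "quad_form B (\<lambda>u v. c u * c v) d = (\<Sum>u\<in>B. d u * c u) * (\<Sum>u\<in>B. d u * c u)"
    unfolding quad_form_def sum_product by (intro sum.cong refl) (simp add: mult_ac)
  then show "0 \<le> quad_form B (\<lambda>u v. c u * c v) d" by simp
qed simp

text \<open>
  The strictly positive functional bounds the trace of a kernel by finitely many coefficients of the
  polynomial that it represents. This is the compactness behind the closedness of the cone of sums of
  squares.
\<close>

lemma trace_le_palindrome_weight_pairing:
  assumes "finite B" "B \<noteq> {}" and "psd_kernel B G" and \<theta>: "\<theta> = 2 * real (card B)"
  shows "(\<Sum>u\<in>B. G u u) \<le> 2 * (\<Sum>u\<in>B. \<Sum>v\<in>B. palindrome_weight \<theta> (rev u @ v) * G u v)"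
proof -
  obtain r where r: "\<forall>u\<in>B. \<forall>v\<in>B. G u v = (\<Sum>k\<in>B. r k u * r k v)"
    using psd_kernel_factor[OF assms(1,3)] ..
  have "(\<Sum>u\<in>B. G u u) = (\<Sum>u\<in>B. \<Sum>k\<in>B. (r k u)\<^sup>2)"
    using r by (intro sum.cong refl) (simp add: power2_eq_square)
  also have "\<dots> = (\<Sum>k\<in>B. \<Sum>u\<in>B. (r k u)\<^sup>2)" by (rule sum.swap)
  also have "\<dots> \<le> (\<Sum>k\<in>B. 2 * quad_form B (hankel (palindrome_weight \<theta>)) (r k))"
    using palindrome_weight_hankel_coercive[OF assms(1,2) \<theta>] by (intro sum_mono) (simp add: pos_divide_le_eq mult.commute)
  also have "\<dots> = 2 * (\<Sum>k\<in>B. \<Sum>u\<in>B. \<Sum>v\<in>B. palindrome_weight \<theta> (rev u @ v) * (r k u * r k v))"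
    unfolding quad_form_def hankel_def sum_distrib_left[symmetric] by (simp add: mult_ac)
  also have "(\<Sum>k\<in>B. \<Sum>u\<in>B. \<Sum>v\<in>B. palindrome_weight \<theta> (rev u @ v) * (r k u * r k v))
      = (\<Sum>u\<in>B. \<Sum>k\<in>B. \<Sum>v\<in>B. palindrome_weight \<theta> (rev u @ v) * (r k u * r k v))"
    by (rule sum.swap)
  also have "\<dots> = (\<Sum>u\<in>B. \<Sum>v\<in>B. \<Sum>k\<in>B. palindrome_weight \<theta> (rev u @ v) * (r k u * r k v))"
    by (intro sum.cong refl sum.swap)
  also have "\<dots> = (\<Sum>u\<in>B. \<Sum>v\<in>B. palindrome_weight \<theta> (rev u @ v) * G u v)"
    using r by (intro sum.cong refl) (simp add: sum_distrib_left)
  finally show ?thesis .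
qed

lemma psd_kernel_entry_le_trace:
  assumes "finite B" "psd_kernel B G" "u \<in> B" "v \<in> B"
  shows "\<bar>G u v\<bar> \<le> (\<Sum>w\<in>B. G w w)"
proof -
  obtain r where r: "\<forall>u\<in>B. \<forall>v\<in>B. G u v = (\<Sum>k\<in>B. r k u * r k v)"
    using psd_kernel_factor[OF assms(1,2)] ..
  have d: "0 \<le> G w w" if "w \<in> B" for w
    using r that by (simp add: sum_nonneg)
  have "\<bar>r k u * r k v\<bar> \<le> (r k u * r k u + r k v * r k v) / 2" for k
  proof -
    have "0 \<le> (\<bar>r k u\<bar> - \<bar>r k v\<bar>)\<^sup>2" by simp
    then show ?thesis by (simp add: power2_eq_square algebra_simps abs_mult)
  qed
  then have "\<bar>\<Sum>k\<in>B. r k u * r k v\<bar> \<le> (\<Sum>k\<in>B. (r k u * r k u + r k v * r k v) / 2)"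
    by (intro order_trans[OF sum_abs] sum_mono)
  then have 1: "\<bar>G u v\<bar> \<le> (G u u + G v v) / 2"
    using r assms(3,4) by (simp add: sum.distrib sum_divide_distrib[symmetric])
  define s where "s = (\<Sum>w\<in>B. G w w)"
  have le: "G w w \<le> s" if "w \<in> B" for w
    unfolding s_def by (rule member_le_sum[OF that _ assms(1)]) (use d in simp)
  have "(G u u + G v v) / 2 \<le> s" using le[OF assms(3)] le[OF assms(4)] by simp
  with 1 show ?thesis unfolding s_def by (rule order_trans)
qed

lemma compact_bounded_functions:
  fixes b :: "'x \<Rightarrow> real"
  shows "compact {g. \<forall>x. \<bar>g x\<bar> \<le> b x}"
proof -
  have "compactin (product_topology (\<lambda>_. euclidean) UNIV) (Pi\<^sub>E UNIV (\<lambda>x. {- b x..b x}))"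
    unfolding compactin_PiE by (simp add: compactin_euclidean_iff)
  then have "compact (Pi\<^sub>E UNIV (\<lambda>x. {- b x..b x}))"
    by (simp add: euclidean_product_topology compactin_euclidean_iff)
  moreover have "Pi\<^sub>E UNIV (\<lambda>x. {- b x..b x}) = {g. \<forall>x. \<bar>g x\<bar> \<le> b x}"
    by (auto simp: PiE_UNIV_domain Pi_iff abs_le_iff minus_le_iff)
  ultimately show ?thesis by simp
qed

lemma continuous_on_coordinate [continuous_intros]:
  "continuous_on S (\<lambda>g :: 'x \<Rightarrow> real. g x)"
  by (rule continuous_on_subset[OF continuous_on_product_coordinates]) simp

lemma closed_psd_kernels:
  "closed {g :: 'w \<times> 'w \<Rightarrow> real. psd_kernel B (\<lambda>u v. g (u, v))}"
proof -
  have "{g :: 'w \<times> 'w \<Rightarrow> real. psd_kernel B (\<lambda>u v. g (u, v))}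
      = (\<Inter>u\<in>B. \<Inter>v\<in>B. {g. g (u, v) = g (v, u)}) \<inter> (\<Inter>c. {g. 0 \<le> quad_form B (\<lambda>u v. g (u, v)) c})"
    by (auto simp: psd_kernel_def)
  also have "closed \<dots>"
    unfolding quad_form_def
    by (intro closed_Int closed_INT ballI closed_Collect_eq closed_Collect_le continuous_intros)
  finally show ?thesis .
qed

lemma linear_coeff_nonneg:
  fixes b c :: real
  assumes "\<And>t. 0 < t \<Longrightarrow> t \<le> 1 \<Longrightarrow> 0 \<le> t * b + t\<^sup>2 * c"
  shows "0 \<le> b"
proof (rule ccontr)
  assume b: "\<not> 0 \<le> b"
  define d where "d = \<bar>c\<bar> + 1"
  have d: "0 < d" "\<bar>c\<bar> \<le> d" by (simp_all add: d_def)
  define t where "t = min 1 (- b / (2 * d))"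
  have t: "0 < t" "t \<le> 1" "t \<le> - b / (2 * d)" using b d by (auto simp: t_def divide_neg_pos)
  have "t * c \<le> t * d" using t d by (intro mult_left_mono) auto
  also have "\<dots> \<le> (- b / (2 * d)) * d" using t d by (intro mult_right_mono) auto
  also have "\<dots> = - b / 2" using d by simp
  finally have "b + t * c < 0" using b by simp
  then have "t * (b + t * c) < 0" using t by (simp add: mult_pos_neg)
  then show False using assms[OF t(1,2)] by (simp add: power2_eq_square algebra_simps)
qed

text \<open>
  Let \<open>G0\<close> minimise the squared distance \<open>\<Phi>\<close> from \<open>f\<close> to the image of the cone of kernels, and let \<open>e\<close>
  be the residual. If it is not zero, it separates: moving from \<open>G0\<close> towards another kernel cannot
  decrease \<open>\<Phi>\<close>, so \<open>e\<close> is nonnegative on the cone; shrinking \<open>G0\<close> cannot either, so \<open>e\<close> is zero on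
  \<open>G0\<close> and its value on \<open>f\<close> is \<open>- \<parallel>e\<parallel>\<^sup>2\<close>.
\<close>

lemma gram_kernel_or_separating_functional:
  assumes B: "finite B" "B \<noteq> {}" and f_rev: "\<And>w. f (rev w) = f w"
    and f_supp: "\<And>w. w \<notin> products B \<Longrightarrow> f w = 0"
  shows "(\<exists>G. psd_kernel B G \<and> (\<forall>w. gram_coeff B G w = f w)) \<or>
    (\<exists>e. (\<forall>w. e (rev w) = e w) \<and> (\<forall>c. 0 \<le> quad_form B (hankel e) c) \<and> (\<Sum>w\<in>products B. e w * f w) < 0)"
proof -
  let ?T = "products B" and ?\<Gamma> = "gram_coeff B"
  define \<theta> where "\<theta> = 2 * real (card B)"
  define \<Phi> where "\<Phi> G = (\<Sum>w\<in>?T. (f w - ?\<Gamma> G w)\<^sup>2)" for G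
  note finT = finite_products[OF B(1)]
  define Z where "Z = (\<lambda>(u :: 'a list) (v :: 'a list). 0 :: real)"
  define F where "F = sqrt (\<Phi> Z)"
  \<comment> \<open>A kernel that does no worse than zero has coefficients within \<open>F\<close> of those of \<open>f\<close>, which bounds its trace by \<open>R\<close>.\<close>
  define R where "R = 2 * (\<Sum>w\<in>?T. \<bar>palindrome_weight \<theta> w\<bar> * (\<bar>f w\<bar> + F))"
  have \<Phi>_nonneg: "0 \<le> \<Phi> G" for G unfolding \<Phi>_def by (intro sum_nonneg) simp
  have bound: "\<bar>G u v\<bar> \<le> R" if G: "psd_kernel B G" "\<Phi> G \<le> \<Phi> Z" and uv: "u \<in> B" "v \<in> B" for G u v
  proof -
    have \<Gamma>_le: "\<bar>?\<Gamma> G w\<bar> \<le> \<bar>f w\<bar> + F" if "w \<in> ?T" for w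
    proof -
      have "(f w - ?\<Gamma> G w)\<^sup>2 \<le> \<Phi> G"
        unfolding \<Phi>_def by (rule member_le_sum[OF that _ finT]) simp
      also have "\<dots> \<le> \<Phi> Z" by (rule G(2))
      finally have "\<bar>f w - ?\<Gamma> G w\<bar> \<le> F" unfolding F_def using real_le_rsqrt real_sqrt_abs real_sqrt_le_mono by metis
      then show ?thesis by linarith
    qed
    have "palindrome_weight \<theta> w * ?\<Gamma> G w \<le> \<bar>palindrome_weight \<theta> w\<bar> * (\<bar>f w\<bar> + F)" if "w \<in> ?T" for w
    proof (rule order_trans[OF abs_ge_self])
      show "\<bar>palindrome_weight \<theta> w * ?\<Gamma> G w\<bar> \<le> \<bar>palindrome_weight \<theta> w\<bar> * (\<bar>f w\<bar> + F)"
        unfolding abs_mult by (rule mult_left_mono[OF \<Gamma>_le[OF that]]) simp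
    qed
    then have "2 * (\<Sum>w\<in>?T. palindrome_weight \<theta> w * ?\<Gamma> G w) \<le> R"
      unfolding R_def by (intro mult_left_mono sum_mono) auto
    then show ?thesis
      using trace_le_palindrome_weight_pairing[OF B G(1) \<theta>_def] psd_kernel_entry_le_trace[OF B(1) G(1) uv]
      unfolding sum_gram_coeff[OF B(1)] by linarith
  qed
  define S where "S = {g :: 'a list \<times> 'a list \<Rightarrow> real. psd_kernel B (\<lambda>u v. g (u, v))} \<inter>
      {g. \<forall>x. \<bar>g x\<bar> \<le> (if x \<in> B \<times> B then R else 0)}"
  have R: "0 \<le> R"
  proof -
    obtain u where "u \<in> B" using B(2) by blast
    moreover have "psd_kernel B Z" by (simp add: Z_def psd_kernel_def quad_form_def)
    ultimately show ?thesis using bound[of Z u u] by (simp add: Z_def)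
  qed
  have "compact S" unfolding S_def by (intro closed_Int_compact closed_psd_kernels compact_bounded_functions)
  moreover have "(\<lambda>_. 0) \<in> S" using R by (simp add: S_def psd_kernel_def quad_form_def)
  then have "S \<noteq> {}" by blast
  moreover have "continuous_on S (\<lambda>g. \<Phi> (\<lambda>u v. g (u, v)))"
  proof -
    have "continuous_on S (\<lambda>g :: 'a list \<times> 'a list \<Rightarrow> real. if rev u @ v = w then g (u, v) else 0)" for u v w
      by (cases "rev u @ v = w") (simp_all add: continuous_intros)
    then show ?thesis unfolding \<Phi>_def gram_coeff_def by (intro continuous_intros)
  qed
  ultimately obtain g0 where g0: "g0 \<in> S" "\<forall>g\<in>S. \<Phi> (\<lambda>u v. g0 (u, v)) \<le> \<Phi> (\<lambda>u v. g (u, v))"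
    using continuous_attains_inf[of S "\<lambda>g. \<Phi> (\<lambda>u v. g (u, v))"] by blast
  define G0 where "G0 u v = g0 (u, v)" for u v
  have psd0: "psd_kernel B G0" using g0(1) by (simp add: S_def G0_def[abs_def])
  have min: "\<Phi> G0 \<le> \<Phi> G" if G: "psd_kernel B G" for G
  proof (cases "\<Phi> G \<le> \<Phi> Z")
    case True
    define g where "g = (\<lambda>(u, v). if u \<in> B \<and> v \<in> B then G u v else 0)"
    have "psd_kernel B (\<lambda>u v. g (u, v))" by (rule psd_kernel_cong[OF _ G]) (simp add: g_def)
    then have "g \<in> S" using bound[OF G True] by (auto simp: S_def g_def)
    then have "\<Phi> G0 \<le> \<Phi> (\<lambda>u v. g (u, v))" using g0(2) by (simp add: G0_def[abs_def])
    also have "\<dots> = \<Phi> G"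
      using gram_coeff_cong[of B G "\<lambda>u v. g (u, v)"] by (simp add: \<Phi>_def g_def)
    finally show ?thesis .
  next
    case False
    have "\<Phi> G0 \<le> \<Phi> Z" using bspec[OF g0(2) \<open>(\<lambda>_. 0) \<in> S\<close>] by (simp only: G0_def[abs_def] Z_def)
    then show ?thesis using False by simp
  qed
  define e where "e w = ?\<Gamma> G0 w - f w" for w
  define E where "E G = (\<Sum>w\<in>?T. e w * ?\<Gamma> G w)" for G
  have expand: "\<Phi> (\<lambda>u v. G0 u v + t * G u v) = \<Phi> G0 + t * (2 * E G) + t\<^sup>2 * (\<Sum>w\<in>?T. (?\<Gamma> G w)\<^sup>2)" for t G
    unfolding \<Phi>_def E_def e_def gram_coeff_linear sum_distrib_left sum.distrib[symmetric]
    by (intro sum.cong refl) (simp add: power2_eq_square algebra_simps)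
  have E_nonneg: "0 \<le> E G" if "psd_kernel B G" for G
  proof -
    have "0 \<le> 2 * E G"
    proof (rule linear_coeff_nonneg)
      fix t :: real assume "0 < t" "t \<le> 1"
      then have "\<Phi> G0 \<le> \<Phi> (\<lambda>u v. G0 u v + t * G u v)" by (intro min psd_kernel_add psd0 that) simp
      then show "0 \<le> t * (2 * E G) + t\<^sup>2 * (\<Sum>w\<in>?T. (?\<Gamma> G w)\<^sup>2)" unfolding expand by simp
    qed
    then show ?thesis by simp
  qed
  have E0: "E G0 \<le> 0"
  proof -
    have "0 \<le> - (2 * E G0)"
    proof (rule linear_coeff_nonneg)
      fix t :: real assume "0 < t" "t \<le> 1"
      have "psd_kernel B (\<lambda>u v. (1 - t) * G0 u v)" using \<open>t \<le> 1\<close> by (intro psd_kernel_scale psd0) simp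
      moreover have "(\<lambda>u v. (1 - t) * G0 u v) = (\<lambda>u v. G0 u v + (- t) * G0 u v)"
        by (intro ext) (simp add: algebra_simps)
      ultimately have "\<Phi> G0 \<le> \<Phi> (\<lambda>u v. G0 u v + (- t) * G0 u v)" by (intro min) simp
      then show "0 \<le> t * (- (2 * E G0)) + t\<^sup>2 * (\<Sum>w\<in>?T. (?\<Gamma> G0 w)\<^sup>2)" unfolding expand by simp
    qed
    then show ?thesis by simp
  qed
  show ?thesis
  proof (cases "\<forall>w\<in>?T. e w = 0")
    case True
    then have "?\<Gamma> G0 w = f w" for w
      using f_supp gram_coeff_outside by (cases "w \<in> ?T") (auto simp: e_def)
    then show ?thesis using psd0 by blast
  next
    case False
    have "e (rev w) = e w" for w
      using gram_coeff_rev[of B G0 w] psd0 f_rev by (simp add: e_def psd_kernel_def)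
    moreover have "0 \<le> quad_form B (hankel e) c" for c
    proof -
      have "quad_form B (hankel e) c = E (\<lambda>u v. c u * c v)"
        unfolding E_def sum_gram_coeff[OF B(1)] quad_form_def hankel_def by (simp add: mult_ac)
      then show ?thesis using E_nonneg[OF psd_kernel_rank_one] by simp
    qed
    moreover have "(\<Sum>w\<in>?T. e w * f w) < 0"
    proof -
      obtain w0 where "w0 \<in> ?T" "e w0 \<noteq> 0" using False by blast
      then have "0 < (\<Sum>w\<in>?T. (e w)\<^sup>2)" using finT by (intro sum_pos2[of _ w0]) auto
      moreover have "(\<Sum>w\<in>?T. e w * f w) = E G0 - (\<Sum>w\<in>?T. (e w)\<^sup>2)"
        unfolding E_def sum_subtractf[symmetric] by (intro sum.cong refl) (simp add: e_def power2_eq_square algebra_simps)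
      ultimately show ?thesis using E0 by simp
    qed
    ultimately show ?thesis by blast
  qed
qed

section \<open>Positive polynomials are sums of squares\<close>

text \<open>
  The symmetry condition on \<open>y\<close> and \<open>z\<close> is the only obstruction to a symmetric operator sending each
  \<open>y u\<close> to \<open>z u\<close>, once the \<open>y u\<close> have a dual family \<open>\<beta>\<close>.
\<close>

lemma exists_symmetric_operator:
  assumes "finite Y"
    and dual: "\<And>u u'. u \<in> Y \<Longrightarrow> u' \<in> Y \<Longrightarrow> ip n (\<beta> u) (y u') = (if u' = u then 1 else 0)"
    and sym: "\<And>u u'. u \<in> Y \<Longrightarrow> u' \<in> Y \<Longrightarrow> ip n (y u) (z u') = ip n (z u) (y u')"
  shows "\<exists>S. symmat n S \<and> (\<forall>u\<in>Y. \<forall>i<n. mv n S (y u) i = z u i)"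
proof -
  \<comment> \<open>The operator \<open>\<Sum> z \<beta>\<^sup>T\<close> already sends \<open>y\<close> to \<open>z\<close>; adding its transpose makes it symmetric, and the double sum cancels what the transpose does on \<open>y\<close>.\<close>
  define s where "s i k = (\<Sum>u\<in>Y. z u i * \<beta> u k + \<beta> u i * z u k)
      - (\<Sum>u\<in>Y. \<Sum>u'\<in>Y. ip n (y u) (z u') * (\<beta> u i * \<beta> u' k))" for i k
  define S where "S = mat n n (\<lambda>(i, k). s i k)"
  have "s i k = s k i" for i k
  proof -
    have "(\<Sum>u\<in>Y. \<Sum>u'\<in>Y. ip n (y u) (z u') * (\<beta> u i * \<beta> u' k))
        = (\<Sum>u'\<in>Y. \<Sum>u\<in>Y. ip n (y u) (z u') * (\<beta> u i * \<beta> u' k))" by (rule sum.swap)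
    also have "\<dots> = (\<Sum>u'\<in>Y. \<Sum>u\<in>Y. ip n (y u') (z u) * (\<beta> u' k * \<beta> u i))"
    proof (intro sum.cong refl)
      fix u u' assume "u' \<in> Y" "u \<in> Y"
      from sym[OF this] show "ip n (y u) (z u') * (\<beta> u i * \<beta> u' k) = ip n (y u') (z u) * (\<beta> u' k * \<beta> u i)"
        by (simp add: ip_commute mult.commute)
    qed
    finally show ?thesis by (simp add: s_def add.commute mult.commute)
  qed
  then have "symmat n S" unfolding symmat_def S_def by (auto intro!: eq_matI)
  moreover have "mv n S (y l) i = z l i" if l: "l \<in> Y" and i: "i < n" for l i
  proof -
    have "mv n S (y l) i = (\<Sum>k<n. (\<Sum>u\<in>Y. z u i * (\<beta> u k * y l k) + \<beta> u i * (z u k * y l k))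
        - (\<Sum>u\<in>Y. \<Sum>u'\<in>Y. ip n (y u) (z u') * \<beta> u i * (\<beta> u' k * y l k)))"
      unfolding mv_def using i
      by (intro sum.cong refl) (simp add: S_def s_def left_diff_distrib sum_distrib_right distrib_right mult.assoc)
    also have "\<dots> = (\<Sum>k<n. \<Sum>u\<in>Y. z u i * (\<beta> u k * y l k) + \<beta> u i * (z u k * y l k))
        - (\<Sum>k<n. \<Sum>u\<in>Y. \<Sum>u'\<in>Y. ip n (y u) (z u') * \<beta> u i * (\<beta> u' k * y l k))"
      by (rule sum_subtractf)
    also have "(\<Sum>k<n. \<Sum>u\<in>Y. z u i * (\<beta> u k * y l k) + \<beta> u i * (z u k * y l k))
        = (\<Sum>u\<in>Y. z u i * ip n (\<beta> u) (y l) + \<beta> u i * ip n (z u) (y l))"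
      by (subst sum.swap) (simp add: ip_def sum.distrib sum_distrib_left)
    also have "(\<Sum>k<n. \<Sum>u\<in>Y. \<Sum>u'\<in>Y. ip n (y u) (z u') * \<beta> u i * (\<beta> u' k * y l k))
        = (\<Sum>u\<in>Y. \<Sum>k<n. \<Sum>u'\<in>Y. ip n (y u) (z u') * \<beta> u i * (\<beta> u' k * y l k))"
      by (rule sum.swap)
    also have "\<dots> = (\<Sum>u\<in>Y. \<Sum>u'\<in>Y. \<Sum>k<n. ip n (y u) (z u') * \<beta> u i * (\<beta> u' k * y l k))"
      by (intro sum.cong refl sum.swap)
    also have "\<dots> = (\<Sum>u\<in>Y. \<Sum>u'\<in>Y. ip n (y u) (z u') * \<beta> u i * ip n (\<beta> u') (y l))"
      by (intro sum.cong refl) (simp add: ip_def[of n "\<beta> _"] sum_distrib_left)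
    also have "\<dots> = (\<Sum>u\<in>Y. \<Sum>u'\<in>Y. if u' = l then ip n (y u) (z u') * \<beta> u i else 0)"
      using l by (intro sum.cong refl) (simp add: dual)
    also have "\<dots> = (\<Sum>u\<in>Y. \<beta> u i * ip n (z u) (y l))"
      using assms(1) l by (intro sum.cong refl) (simp add: sym)
    also have "(\<Sum>u\<in>Y. z u i * ip n (\<beta> u) (y l) + \<beta> u i * ip n (z u) (y l))
        = (\<Sum>u\<in>Y. if u = l then z u i else 0) + (\<Sum>u\<in>Y. \<beta> u i * ip n (z u) (y l))"
      unfolding sum.distrib[symmetric] using l by (intro sum.cong refl) (auto simp: dual)
    finally show ?thesis using assms(1) l by simp
  qed
  ultimately show ?thesis by blast
qed

text \<open>
  The letters should act by left multiplication on polynomials supported on \<open>B\<close>, with \<open>hankel \<phi>\<close> as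
  inner product. Factoring the kernel realises the words of \<open>B\<close> as vectors \<open>b u\<close> of a Euclidean space,
  linearly independent by coercivity. Multiplication by a letter is symmetric where it is defined,
  namely on the words \<open>u\<close> with \<open>v # u \<in> B\<close>, and extends to a symmetric matrix. Closure of \<open>B\<close> under
  suffixes lets every word of \<open>B\<close> be reached from the empty word inside \<open>B\<close>.
\<close>

lemma gns_representation:
  fixes \<phi> :: "'v list \<Rightarrow> real"
  assumes B: "finite B" "[] \<in> B" and suffix: "\<And>v w. v # w \<in> B \<Longrightarrow> w \<in> B"
    and \<phi>_rev: "\<And>w. \<phi> (rev w) = \<phi> w"
    and \<delta>: "\<delta> > 0" and coercive: "\<And>c. \<delta> * (\<Sum>u\<in>B. (c u)\<^sup>2) \<le> quad_form B (hankel \<phi>) c"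
  shows "\<exists>n \<sigma> \<Omega>. n > 0 \<and> (\<forall>v. symmat n (\<sigma> v)) \<and>
    (\<forall>u\<in>B. \<forall>v\<in>B. ip n \<Omega> (word_act n \<sigma> (rev u @ v) \<Omega>) = \<phi> (rev u @ v))"
proof -
  have "psd_kernel B (hankel \<phi>)"
    unfolding psd_kernel_def
  proof (intro conjI ballI allI)
    fix u v show "hankel \<phi> u v = hankel \<phi> v u"
      using \<phi>_rev[of "rev u @ v"] by (simp add: hankel_def)
  next
    fix c :: "'v list \<Rightarrow> real"
    have "0 \<le> \<delta> * (\<Sum>u\<in>B. (c u)\<^sup>2)" using \<delta> by (simp add: sum_nonneg)
    then show "0 \<le> quad_form B (hankel \<phi>) c" using coercive[of c] by linarith
  qed
  from psd_kernel_factor[OF B(1) this] obtain r where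
    r: "\<forall>u\<in>B. \<forall>v\<in>B. hankel \<phi> u v = (\<Sum>k\<in>B. r k u * r k v)" ..
  define N where "N = card B"
  have N: "N > 0" unfolding N_def using B by (auto simp: card_gt_0_iff)
  obtain h where h: "bij_betw h {0..<N} B" unfolding N_def using ex_bij_betw_nat_finite[OF B(1)] ..
  define b where "b u i = r (h i) u" for u i
  have ipb: "ip N (b u) (b v) = \<phi> (rev u @ v)" if "u \<in> B" "v \<in> B" for u v
  proof -
    have "ip N (b u) (b v) = (\<Sum>i\<in>{0..<N}. r (h i) u * r (h i) v)"
      by (simp add: ip_def b_def lessThan_atLeast0)
    also have "\<dots> = (\<Sum>k\<in>B. r k u * r k v)"
      by (rule sum.reindex_bij_betw[OF h])
    finally show ?thesis using r that by (simp add: hankel_def)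
  qed
  define M where "M = range (\<lambda>\<beta> w. ip N \<beta> (b w))"
  have MI: "(\<lambda>w. ip N \<beta> (b w)) \<in> M" for \<beta> unfolding M_def by (rule range_eqI[OF refl])
  have "\<exists>m\<in>M. \<forall>w\<in>B. m w = (if w = w0 then 1 else 0)" if "w0 \<in> B" for w0
  proof (rule separating_subspace_contains_deltas[OF B(1) _ _ _ that])
    fix m m' assume "m \<in> M" "m' \<in> M"
    then obtain \<beta> \<beta>' where "m = (\<lambda>w. ip N \<beta> (b w))" "m' = (\<lambda>w. ip N \<beta>' (b w))" unfolding M_def by blast
    then have "(\<lambda>w. m w + m' w) = (\<lambda>w. ip N (\<lambda>i. \<beta> i + \<beta>' i) (b w))"
      by (simp add: ip_def sum.distrib algebra_simps)
    then show "(\<lambda>w. m w + m' w) \<in> M" by (simp only: MI)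
  next
    fix c m assume "m \<in> M"
    then obtain \<beta> where "m = (\<lambda>w. ip N \<beta> (b w))" unfolding M_def by blast
    then have "(\<lambda>w. c * m w) = (\<lambda>w. ip N (\<lambda>i. c * \<beta> i) (b w))"
      by (simp add: ip_def sum_distrib_left mult.assoc)
    then show "(\<lambda>w. c * m w) \<in> M" by (simp only: MI)
  next
    fix q assume q: "\<forall>m\<in>M. (\<Sum>w\<in>B. q w * m w) = 0"
    have ipsum: "ip N (\<lambda>i. \<Sum>u\<in>B. q u * b u i) g = (\<Sum>u\<in>B. q u * ip N (b u) g)" for g
      unfolding ip_def sum_distrib_right sum_distrib_left by (subst sum.swap) (simp add: mult.assoc)
    have "quad_form B (hankel \<phi>) q = (\<Sum>u\<in>B. \<Sum>w\<in>B. q w * (q u * ip N (b u) (b w)))"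
      unfolding quad_form_def hankel_def by (intro sum.cong refl) (simp add: ipb)
    also have "\<dots> = (\<Sum>w\<in>B. \<Sum>u\<in>B. q w * (q u * ip N (b u) (b w)))" by (rule sum.swap)
    also have "\<dots> = (\<Sum>w\<in>B. q w * ip N (\<lambda>i. \<Sum>u\<in>B. q u * b u i) (b w))"
      unfolding ipsum sum_distrib_left ..
    also have "\<dots> = 0" using bspec[OF q MI] .
    finally have "\<delta> * (\<Sum>u\<in>B. (q u)\<^sup>2) \<le> 0" using coercive[of q] by simp
    then have "(\<Sum>u\<in>B. (q u)\<^sup>2) \<le> 0" using \<delta> by (simp add: mult_le_0_iff)
    then have "(\<Sum>u\<in>B. (q u)\<^sup>2) = 0" by (intro order_antisym sum_nonneg) simp_all
    then show "\<forall>w\<in>B. q w = 0" using B(1) by (simp add: sum_nonneg_eq_0_iff)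
  qed
  then have "\<forall>w0\<in>B. \<exists>\<beta>. \<forall>w\<in>B. ip N \<beta> (b w) = (if w = w0 then 1 else 0)" unfolding M_def by auto
  then obtain \<beta> where \<beta>: "\<forall>w0\<in>B. \<forall>w\<in>B. ip N (\<beta> w0) (b w) = (if w = w0 then 1 else 0)" by metis
  have "\<exists>S. symmat N S \<and> (\<forall>u\<in>{u\<in>B. v # u \<in> B}. \<forall>i<N. mv N S (b u) i = b (v # u) i)" for v
  proof (rule exists_symmetric_operator[of _ _ \<beta>])
    fix u u' assume "u \<in> {u\<in>B. v # u \<in> B}" "u' \<in> {u\<in>B. v # u \<in> B}"
    then show "ip N (b u) (b (v # u')) = ip N (b (v # u)) (b u')" by (simp add: ipb)
  qed (use B(1) \<beta> in auto)
  then have "\<forall>v. \<exists>S. symmat N S \<and> (\<forall>u\<in>{u\<in>B. v # u \<in> B}. \<forall>i<N. mv N S (b u) i = b (v # u) i)" ..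
  from choice[OF this] obtain \<sigma> where
    "\<forall>v. symmat N (\<sigma> v) \<and> (\<forall>u\<in>{u\<in>B. v # u \<in> B}. \<forall>i<N. mv N (\<sigma> v) (b u) i = b (v # u) i)" ..
  then have \<sigma>: "\<And>v. symmat N (\<sigma> v)"
    "\<And>v u i. u \<in> B \<Longrightarrow> v # u \<in> B \<Longrightarrow> i < N \<Longrightarrow> mv N (\<sigma> v) (b u) i = b (v # u) i"
    by auto
  have act: "word_act N \<sigma> u (b []) i = b u i" if "u \<in> B" "i < N" for u i
    using that
  proof (induction u arbitrary: i)
    case (Cons v u)
    have u: "u \<in> B" using suffix Cons.prems(1) .
    have "mv N (\<sigma> v) (word_act N \<sigma> u (b [])) = mv N (\<sigma> v) (b u)"
      by (rule mv_cong) (rule Cons.IH[OF u])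
    then show ?case using \<sigma>(2)[OF u Cons.prems] by simp
  qed simp
  have "ip N (b []) (word_act N \<sigma> (rev u @ v) (b [])) = \<phi> (rev u @ v)" if "u \<in> B" "v \<in> B" for u v
  proof -
    have "ip N (b []) (word_act N \<sigma> (rev u @ v) (b [])) = ip N (word_act N \<sigma> u (b [])) (word_act N \<sigma> v (b []))"
      by (simp add: ip_word_act_rev[OF \<sigma>(1)])
    also have "\<dots> = ip N (b u) (b v)" by (intro ip_cong act that)
    finally show ?thesis by (simp add: ipb that)
  qed
  then show ?thesis using N \<sigma>(1) by blast
qed

lemma lookup_nc_transpose: "Poly_Mapping.lookup (nc_transpose p) w = Poly_Mapping.lookup p (rev w)"
  by (simp add: nc_transpose_def map_key.rep_eq)

lemma lookup_sum_list: "Poly_Mapping.lookup (sum_list ps) w = (\<Sum>p\<leftarrow>ps. Poly_Mapping.lookup p w)"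
  by (induction ps) (simp_all add: lookup_add)

lemma lookup_hermitian_square:
  assumes B: "finite B" and r: "Poly_Mapping.keys r \<subseteq> B"
  shows "Poly_Mapping.lookup (nc_transpose r * r) w
    = gram_coeff B (\<lambda>u v. Poly_Mapping.lookup r u * Poly_Mapping.lookup r v) w"
proof -
  let ?c = "Poly_Mapping.lookup r"
  have 1: "r = (\<Sum>u\<in>B. Poly_Mapping.single u (?c u))"
    using r by (intro poly_mapping_eqI) (auto simp: lookup_sum lookup_single when_def B in_keys_iff)
  have 2: "nc_transpose r = (\<Sum>u\<in>B. Poly_Mapping.single (rev u) (?c u))"
  proof (rule poly_mapping_eqI)
    fix k :: "'a list"
    have "rev u = k \<longleftrightarrow> u = rev k" for u by auto
    then show "Poly_Mapping.lookup (nc_transpose r) k = Poly_Mapping.lookup (\<Sum>u\<in>B. Poly_Mapping.single (rev u) (?c u)) k"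
      using r by (auto simp: lookup_nc_transpose lookup_sum lookup_single when_def B in_keys_iff)
  qed
  have "nc_transpose r * r = (\<Sum>u\<in>B. \<Sum>v\<in>B. Poly_Mapping.single (rev u @ v) (?c u * ?c v))"
    using arg_cong2[where f = "(*)", OF 2 1] by (simp add: sum_product mult_single plus_list_def)
  then show ?thesis by (simp add: lookup_sum lookup_single when_def gram_coeff_def)
qed

text \<open>
  A sum of squares supported on \<open>B\<close> is the same as a positive semidefinite Gram kernel on \<open>B\<close>. If
  there is none, a slight perturbation of the separating functional is represented by matrices
  \<open>\<sigma>\<close> and a vector \<open>\<Omega>\<close>, and \<open>\<langle>\<Omega>, f(\<sigma>) \<Omega>\<rangle>\<close> is its negative value at \<open>f\<close>.
\<close>

theorem positive_imp_sum_of_squares: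
  fixes f :: "'v ncpoly"
  assumes B: "finite B" "[] \<in> B" and suffix: "\<And>v w. v # w \<in> B \<Longrightarrow> w \<in> B"
    and sym: "nc_symmetric f" and keys: "Poly_Mapping.keys f \<subseteq> products B"
    and pos: "\<And>n \<sigma> g. n > 0 \<Longrightarrow> (\<And>v. symmat n (\<sigma> v)) \<Longrightarrow>
      0 \<le> ip n g (mv n (nc_eval n \<sigma> f) g)"
  shows "\<exists>\<Lambda>. f = column_square \<Lambda> \<and> (\<forall>r\<in>set \<Lambda>. Poly_Mapping.keys r \<subseteq> B)"
proof -
  let ?f = "Poly_Mapping.lookup f" and ?T = "products B"
  have Bne: "B \<noteq> {}" using B(2) by blast
  have f_out: "?f w = 0" if "w \<notin> ?T" for w using keys that by (auto simp: in_keys_iff)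
  have "\<nexists>e. (\<forall>w. e (rev w) = e w) \<and> (\<forall>c. 0 \<le> quad_form B (hankel e) c) \<and> (\<Sum>w\<in>?T. e w * ?f w) < 0"
  proof
    assume "\<exists>e. (\<forall>w. e (rev w) = e w) \<and> (\<forall>c. 0 \<le> quad_form B (hankel e) c) \<and> (\<Sum>w\<in>?T. e w * ?f w) < 0"
    then obtain e where e: "\<And>w. e (rev w) = e w" "\<And>c. 0 \<le> quad_form B (hankel e) c" "(\<Sum>w\<in>?T. e w * ?f w) < 0"
      by blast
    define \<theta> where "\<theta> = 2 * real (card B)"
    define s where "s = (\<Sum>w\<in>?T. e w * ?f w)"
    define t where "t = (\<Sum>w\<in>?T. palindrome_weight \<theta> w * ?f w)"
    \<comment> \<open>Small enough for \<open>s + \<delta> t\<close> to remain negative.\<close>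
    define \<delta> where "\<delta> = - s / (2 * (\<bar>t\<bar> + 1))"
    have \<delta>: "\<delta> > 0" using e(3) unfolding s_def[symmetric] \<delta>_def by (simp add: divide_neg_pos)
    define \<phi> where "\<phi> w = e w + \<delta> * palindrome_weight \<theta> w" for w
    have "\<delta> * t \<le> \<delta> * (\<bar>t\<bar> + 1)" using \<delta> by (intro mult_left_mono) auto
    also have "\<dots> = - s / 2"
    proof -
      have "\<bar>t\<bar> + 1 \<noteq> 0" by linarith
      then show ?thesis unfolding \<delta>_def by (metis (no_types, opaque_lifting) divide_divide_eq_left mult.commute nonzero_eq_divide_eq)
    qed
    finally have neg: "s + \<delta> * t < 0" using e(3) unfolding s_def[symmetric] by simp
    have "hankel \<phi> = (\<lambda>u v. hankel e u v + \<delta> * hankel (palindrome_weight \<theta>) u v)"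
      by (intro ext) (simp add: hankel_def \<phi>_def)
    then have quad_\<phi>: "quad_form B (hankel \<phi>) c = quad_form B (hankel e) c + \<delta> * quad_form B (hankel (palindrome_weight \<theta>)) c" for c
      by (simp add: quad_form_linear)
    have "\<exists>n \<sigma> \<Omega>. n > 0 \<and> (\<forall>v. symmat n (\<sigma> v)) \<and>
      (\<forall>u\<in>B. \<forall>v\<in>B. ip n \<Omega> (word_act n \<sigma> (rev u @ v) \<Omega>) = \<phi> (rev u @ v))"
    proof (rule gns_representation[OF B suffix])
      show "\<phi> (rev w) = \<phi> w" for w by (simp add: \<phi>_def e(1) palindrome_weight_rev)
      show "0 < \<delta> / 2" using \<delta> by simp
      show "\<delta> / 2 * (\<Sum>u\<in>B. (c u)\<^sup>2) \<le> quad_form B (hankel \<phi>) c" for c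
      proof -
        have "\<delta> * ((\<Sum>u\<in>B. (c u)\<^sup>2) / 2) \<le> \<delta> * quad_form B (hankel (palindrome_weight \<theta>)) c"
          using palindrome_weight_hankel_coercive[OF B(1) Bne \<theta>_def] \<delta> by (intro mult_left_mono) auto
        then show ?thesis using e(2)[of c] unfolding quad_\<phi> by simp
      qed
    qed
    then obtain n \<sigma> \<Omega> where n: "n > 0" and \<sigma>: "\<And>v. symmat n (\<sigma> v)" and
      rep: "\<forall>u\<in>B. \<forall>v\<in>B. ip n \<Omega> (word_act n \<sigma> (rev u @ v) \<Omega>) = \<phi> (rev u @ v)" by blast
    have "0 \<le> ip n \<Omega> (mv n (nc_eval n \<sigma> f) \<Omega>)" by (rule pos[OF n \<sigma>])
    also have "\<dots> = (\<Sum>w\<in>Poly_Mapping.keys f. ?f w * ip n \<Omega> (word_act n \<sigma> w \<Omega>))"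
      by (rule ip_nc_eval[OF symmat_carrier[OF \<sigma>]])
    also have "\<dots> = (\<Sum>w\<in>?T. ?f w * ip n \<Omega> (word_act n \<sigma> w \<Omega>))"
      by (rule sum.mono_neutral_left[OF finite_products[OF B(1)] keys]) (simp add: in_keys_iff)
    also have "\<dots> = (\<Sum>w\<in>?T. e w * ?f w + \<delta> * (palindrome_weight \<theta> w * ?f w))"
    proof (intro sum.cong refl)
      fix w assume "w \<in> ?T"
      then obtain u v where "u \<in> B" "v \<in> B" "w = rev u @ v" unfolding products_def by auto
      then have "ip n \<Omega> (word_act n \<sigma> w \<Omega>) = \<phi> w" using rep by blast
      then show "?f w * ip n \<Omega> (word_act n \<sigma> w \<Omega>) = e w * ?f w + \<delta> * (palindrome_weight \<theta> w * ?f w)"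
        by (simp add: \<phi>_def algebra_simps)
    qed
    also have "\<dots> = s + \<delta> * t" by (simp add: s_def t_def sum.distrib sum_distrib_left)
    finally show False using neg by simp
  qed
  then obtain G where G: "psd_kernel B G" "\<And>w. gram_coeff B G w = ?f w"
    using gram_kernel_or_separating_functional[of B ?f, OF B(1) Bne lookup_rev[OF sym] f_out] by blast
  obtain r where r: "\<forall>u\<in>B. \<forall>v\<in>B. G u v = (\<Sum>k\<in>B. r k u * r k v)"
    using psd_kernel_factor[OF B(1) G(1)] ..
  obtain ks where ks: "set ks = B" "distinct ks" using finite_distinct_list[OF B(1)] by blast
  define \<Lambda> where "\<Lambda> = map (\<lambda>k. poly_on B (r k)) ks"
  have "Poly_Mapping.lookup (column_square \<Lambda>) w = ?f w" for w
  proof -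
    have "Poly_Mapping.lookup (column_square \<Lambda>) w
        = (\<Sum>k\<leftarrow>ks. Poly_Mapping.lookup (nc_transpose (poly_on B (r k)) * poly_on B (r k)) w)"
      by (simp add: column_square_def lookup_sum_list \<Lambda>_def comp_def)
    also have "\<dots> = (\<Sum>k\<in>B. gram_coeff B (\<lambda>u v. Poly_Mapping.lookup (poly_on B (r k)) u * Poly_Mapping.lookup (poly_on B (r k)) v) w)"
      using ks by (simp add: sum_list_distinct_conv_sum_set lookup_hermitian_square[OF B(1) keys_poly_on[OF B(1)]])
    also have "\<dots> = (\<Sum>k\<in>B. \<Sum>u\<in>B. \<Sum>v\<in>B. if rev u @ v = w then r k u * r k v else 0)"
      unfolding gram_coeff_def by (intro sum.cong refl) (simp add: lookup_poly_on[OF B(1)])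
    also have "\<dots> = (\<Sum>u\<in>B. \<Sum>k\<in>B. \<Sum>v\<in>B. if rev u @ v = w then r k u * r k v else 0)"
      by (rule sum.swap)
    also have "\<dots> = (\<Sum>u\<in>B. \<Sum>v\<in>B. \<Sum>k\<in>B. if rev u @ v = w then r k u * r k v else 0)"
      by (intro sum.cong refl sum.swap)
    also have "\<dots> = gram_coeff B G w"
      unfolding gram_coeff_def using r by (intro sum.cong refl) auto
    finally show ?thesis by (simp add: G(2))
  qed
  then have "f = column_square \<Lambda>" by (intro poly_mapping_eqI) simp
  moreover have "\<forall>r\<in>set \<Lambda>. Poly_Mapping.keys r \<subseteq> B"
    by (auto simp: \<Lambda>_def dest: subsetD[OF keys_poly_on[OF B(1)]])
  ultimately show ?thesis by blast
qed

section \<open>The theorem\<close>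

lemma isometry_inclusion:
  assumes "m \<le> n"
  shows "isometry m n (mat n m (\<lambda>(i, j). if i = j then 1 else 0))"
  unfolding isometry_def
proof (intro conjI ballI)
  fix v :: "real vec" assume v: "v \<in> carrier_vec m"
  let ?V = "mat n m (\<lambda>(i, j). if i = j then 1 else 0) :: real mat"
  have "(?V *\<^sub>v v) $ i = (if i < m then v $ i else 0)" if "i < n" for i
    using that v by (auto simp: scalar_prod_def if_distrib[of "\<lambda>x. x * _"] cong: if_cong)
  then have "(?V *\<^sub>v v) \<bullet> (?V *\<^sub>v v) = (\<Sum>i<n. if i < m then v $ i * v $ i else 0)"
    unfolding scalar_prod_def by (intro sum.cong) auto
  also have "\<dots> = (\<Sum>i\<in>{i\<in>{..<n}. i < m}. v $ i * v $ i)"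
    by (rule sum.inter_filter[symmetric]) simp
  also have "{i\<in>{..<n}. i < m} = {0..<m}" using assms by auto
  finally show "(?V *\<^sub>v v) \<bullet> (?V *\<^sub>v v) = v \<bullet> v" using v by (simp add: scalar_prod_def)
qed simp

text \<open>
  Direct sums of a point of level \<open>m\<close> reach level \<open>n * m\<close>, and compression by the inclusion of the first
  \<open>n\<close> coordinates comes back to level \<open>n\<close>.
\<close>

lemma matrix_convex_nonempty:
  assumes V: "matrix_convex V" and m: "m > 0" "V m \<noteq> {}" and n: "n > 0"
  shows "V n \<noteq> {}"
proof -
  have ds: "direct_sum X Y \<in> V (k + l)" if "k > 0" "l > 0" "X \<in> V k" "Y \<in> V l" for k l X Y
  proof -
    have "\<forall>X\<in>V k. \<forall>Y\<in>V l. direct_sum X Y \<in> V (k + l)"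
      using V that(1,2) by (simp add: matrix_convex_def domain1_def)
    then show ?thesis using that(3,4) by blast
  qed
  have "V (Suc k * m) \<noteq> {}" for k
  proof (induction k)
    case (Suc k)
    then obtain X Y where "X \<in> V m" "Y \<in> V (Suc k * m)" using m(2) by blast
    from ds[OF _ _ this] m(1) have "direct_sum X Y \<in> V (m + Suc k * m)" by simp
    then show ?case by auto
  qed (use m in simp)
  from this[of "n - 1"] have "V (n * m) \<noteq> {}" using n by simp
  then obtain X where X: "X \<in> V (n * m)" by blast
  have nm: "n * m > 0" using n m(1) by simp
  from V have "\<forall>m>0. \<forall>n>0. \<forall>U. isometry m n U \<longrightarrow> (\<forall>X\<in>V n. (\<lambda>j. transpose_mat U * X j * U) \<in> V m)"
    unfolding matrix_convex_def by (rule conjunct2)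
  with n nm have "\<forall>U. isometry n (n * m) U \<longrightarrow> (\<forall>X\<in>V (n * m). (\<lambda>j. transpose_mat U * X j * U) \<in> V n)"
    by blast
  moreover have "n \<le> n * m" using m(1) by simp
  ultimately show ?thesis using isometry_inclusion[of n "n * m"] X by blast
qed

text \<open>
  Words with one \<open>x\<close> alone would not be closed under suffixes, so words without \<open>x\<close> are admitted to \<open>B\<close>
  as well. In \<open>r\<^sup>T r\<close> a word with two letters \<open>x\<close> arises only from the linear part of \<open>r\<close>, which may
  therefore replace \<open>r\<close>.
\<close>

lemma sum_of_squares_quadratic:
  fixes f :: "'g::finite axvar ncpoly"
  assumes sym: "nc_symmetric f" and f: "\<And>w. w \<in> Poly_Mapping.keys f \<Longrightarrow> length (filter is_Xvar w) = 2"
    and pos: "\<And>n A X. n > 0 \<Longrightarrow> A \<in> sym_tuples n \<Longrightarrow> X \<in> sym_tuples n \<Longrightarrow> psd n (eval_ax n f A X)"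
  shows "\<exists>\<Lambda>. (\<forall>r\<in>set \<Lambda>. linear_in_x r) \<and> f = column_square \<Lambda>"
proof -
  define B where "B = {w :: 'g axvar list. length (filter is_Avar w) \<le> degree_a f \<and> length (filter is_Xvar w) \<le> 1}"
  have finB: "finite B" unfolding B_def by (rule finite_bounded_words)
  have nil: "[] \<in> B" by (simp add: B_def)
  have suffix: "w \<in> B" if "v # w \<in> B" for v w
    using that unfolding B_def by (cases v) auto
  have keys: "Poly_Mapping.keys f \<subseteq> products B"
  proof
    fix w assume w: "w \<in> Poly_Mapping.keys f"
    have da: "length (filter is_Avar w) \<le> degree_a f" using w degree_in_le[of is_Avar f "degree_a f"] by simp
    have "length (filter is_Xvar w) \<ge> 2" using f[OF w] by simp
    from split_first_two_x[OF this] obtain a i b j c where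
      s: "w = a @ Xvar i # b @ Xvar j # c" "filter is_Xvar a = []" "filter is_Xvar b = []"
         "length (filter is_Xvar w) = length (filter is_Xvar c) + 2" by metis
    have "rev (a @ [Xvar i]) \<in> B" "b @ Xvar j # c \<in> B"
      using s f[OF w] da unfolding B_def by (simp_all flip: rev_filter)
    moreover have "w = rev (rev (a @ [Xvar i])) @ (b @ Xvar j # c)" using s(1) by simp
    ultimately show "w \<in> products B" using productsI by metis
  qed
  have "\<exists>\<Lambda>. f = column_square \<Lambda> \<and> (\<forall>r\<in>set \<Lambda>. Poly_Mapping.keys r \<subseteq> B)"
  proof (rule positive_imp_sum_of_squares[OF finB nil suffix sym keys])
    fix n and \<sigma> :: "'g axvar \<Rightarrow> real mat" and g :: "nat \<Rightarrow> real"
    assume n: "n > 0" and \<sigma>: "\<And>v. symmat n (\<sigma> v)"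
    have "\<sigma> = assign_ax (\<lambda>j. \<sigma> (Avar j)) (\<lambda>j. \<sigma> (Xvar j))"
    proof
      fix v show "\<sigma> v = assign_ax (\<lambda>j. \<sigma> (Avar j)) (\<lambda>j. \<sigma> (Xvar j)) v" by (cases v) simp_all
    qed
    moreover have "psd n (eval_ax n f (\<lambda>j. \<sigma> (Avar j)) (\<lambda>j. \<sigma> (Xvar j)))"
      using \<sigma> by (intro pos n) (simp_all add: sym_tuples_def symmat_def)
    ultimately have "psd n (nc_eval n \<sigma> f)" by (simp add: eval_ax_def)
    then show "0 \<le> ip n g (mv n (nc_eval n \<sigma> f) g)" by (rule psd_ip)
  qed
  then obtain \<Lambda> where \<Lambda>: "f = column_square \<Lambda>" "\<forall>r\<in>set \<Lambda>. Poly_Mapping.keys r \<subseteq> B" by blast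
  define lin where "lin r = poly_on {w \<in> Poly_Mapping.keys r. length (filter is_Xvar w) = 1} (Poly_Mapping.lookup r)"
    for r :: "'g axvar ncpoly"
  have lookup_lin: "Poly_Mapping.lookup (lin r) w = (if length (filter is_Xvar w) = 1 then Poly_Mapping.lookup r w else 0)" for r w
    by (simp add: lin_def lookup_poly_on in_keys_iff)
  have keys_lin: "Poly_Mapping.keys (lin r) \<subseteq> Poly_Mapping.keys r" for r
    by (auto simp: in_keys_iff lookup_lin split: if_splits)
  have square: "Poly_Mapping.lookup (nc_transpose (lin r) * lin r) w
      = (if length (filter is_Xvar w) = 2 then Poly_Mapping.lookup (nc_transpose r * r) w else 0)"
    if "r \<in> set \<Lambda>" for r w
  proof -
    have r: "Poly_Mapping.keys r \<subseteq> B" using \<Lambda>(2) that by blast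
    show ?thesis
      unfolding lookup_hermitian_square[OF finB r] lookup_hermitian_square[OF finB order_trans[OF keys_lin r]]
    proof (cases "length (filter is_Xvar w) = 2")
      case True
      have "gram_coeff B (\<lambda>u v. Poly_Mapping.lookup (lin r) u * Poly_Mapping.lookup (lin r) v) w
          = gram_coeff B (\<lambda>u v. Poly_Mapping.lookup r u * Poly_Mapping.lookup r v) w"
        unfolding gram_coeff_def
      proof (intro sum.cong refl)
        fix u v assume uv: "u \<in> B" "v \<in> B"
        have "length (filter is_Xvar u) = 1 \<and> length (filter is_Xvar v) = 1" if "rev u @ v = w"
          using uv True unfolding that[symmetric] B_def by (auto simp flip: rev_filter)
        then show "(if rev u @ v = w then Poly_Mapping.lookup (lin r) u * Poly_Mapping.lookup (lin r) v else 0)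
            = (if rev u @ v = w then Poly_Mapping.lookup r u * Poly_Mapping.lookup r v else 0)"
          by (simp add: lookup_lin)
      qed
      then show "gram_coeff B (\<lambda>u v. Poly_Mapping.lookup (lin r) u * Poly_Mapping.lookup (lin r) v) w
          = (if length (filter is_Xvar w) = 2 then gram_coeff B (\<lambda>u v. Poly_Mapping.lookup r u * Poly_Mapping.lookup r v) w else 0)"
        using True by simp
    next
      case False
      have "gram_coeff B (\<lambda>u v. Poly_Mapping.lookup (lin r) u * Poly_Mapping.lookup (lin r) v) w = 0"
        unfolding gram_coeff_def
      proof (intro sum.neutral ballI)
        fix u v
        have "\<not> (length (filter is_Xvar u) = 1 \<and> length (filter is_Xvar v) = 1)" if "rev u @ v = w"
          using False unfolding that[symmetric] by (auto simp flip: rev_filter)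
        then show "(if rev u @ v = w then Poly_Mapping.lookup (lin r) u * Poly_Mapping.lookup (lin r) v else 0) = 0"
          by (auto simp: lookup_lin)
      qed
      then show "gram_coeff B (\<lambda>u v. Poly_Mapping.lookup (lin r) u * Poly_Mapping.lookup (lin r) v) w
          = (if length (filter is_Xvar w) = 2 then gram_coeff B (\<lambda>u v. Poly_Mapping.lookup r u * Poly_Mapping.lookup r v) w else 0)"
        using False by simp
    qed
  qed
  have "Poly_Mapping.lookup (column_square (map lin \<Lambda>)) w = Poly_Mapping.lookup f w" for w
  proof -
    have "Poly_Mapping.lookup (column_square (map lin \<Lambda>)) w
        = (\<Sum>r\<leftarrow>\<Lambda>. Poly_Mapping.lookup (nc_transpose (lin r) * lin r) w)"
      by (simp add: column_square_def lookup_sum_list comp_def)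
    also have "\<dots> = (\<Sum>r\<leftarrow>\<Lambda>. if length (filter is_Xvar w) = 2 then Poly_Mapping.lookup (nc_transpose r * r) w else 0)"
      using square by (intro arg_cong[of _ _ sum_list] map_cong refl) blast
    also have "\<dots> = (if length (filter is_Xvar w) = 2 then Poly_Mapping.lookup (column_square \<Lambda>) w else 0)"
      by (simp add: column_square_def lookup_sum_list comp_def)
    also have "\<dots> = Poly_Mapping.lookup f w"
      using f[of w] \<Lambda>(1) by (auto simp: in_keys_iff)
    finally show ?thesis .
  qed
  then have "f = column_square (map lin \<Lambda>)" by (intro poly_mapping_eqI) simp
  moreover have "\<forall>r\<in>set (map lin \<Lambda>). linear_in_x r"
    by (auto simp: linear_in_x_def in_keys_iff lookup_lin split: if_splits)
  ultimately show ?thesis by blast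
qed

theorem theorem1p10:
  fixes p :: "'g::finite axvar ncpoly"
    and W :: "nat \<Rightarrow> ('g mtuple \<times> 'g mtuple) set"
    and d_a d_x :: nat
  assumes "nc_symmetric p"
    and "degree_a p = d_a"
    and "degree_x p = d_x"
    and "d_x \<ge> 2"
    and "domain2 W"
    and "open_in_a W"
    and "\<And>n A X H. n > 0 \<Longrightarrow> (A, X) \<in> W n \<Longrightarrow> H \<in> sym_tuples n \<Longrightarrow>
           psd n (eval_axh n (hessian_x p) A X H)"
  shows "((\<exists>q. q \<noteq> 0 \<and> degree_a q \<le> d_a \<and> degree_x q \<le> d_x - 2 \<and> vanishes_on q W) \<or>
          (degree_x p \<le> 2 \<and>
           (\<forall>n>0. \<forall>A\<in>proj_a n (W n). globally_convex n (\<lambda>X. eval_ax n p A X))))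
       \<and> (\<forall>\<V> :: nat \<Rightarrow> 'g mtuple set.
            matrix_convex \<V> \<and> (\<forall>n>0. W n = sym_tuples n \<times> \<V> n) \<longrightarrow>
              (\<exists>q. q \<noteq> 0 \<and> degree_a q \<le> d_a \<and> degree_x q \<le> d_x - 2 \<and> vanishes_on q W) \<or>
              (\<exists>\<Lambda> L. (\<forall>f\<in>set \<Lambda>. linear_in_x f) \<and> degree_x L \<le> 1 \<and>
                 p = L + column_square \<Lambda>))"
proof (cases "degree_x p \<ge> 3")
  case True
  have "\<exists>q. q \<noteq> 0 \<and> degree_a q \<le> degree_a p \<and> degree_x q \<le> degree_x p - 2 \<and> vanishes_on q W"
    by (rule degree_at_least_3_imp_vanishing[OF assms(1,5) True assms(7)])
  then show ?thesis unfolding assms(2,3) by blast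
next
  case False
  then have deg: "degree_x p \<le> 2" by simp
  have pos: "psd n (eval_ax n (x2_part p) A H)"
    if "n > 0" "(A, X) \<in> W n" "H \<in> sym_tuples n" for n A X H
  proof -
    have "psd n ((1 / 2) \<cdot>\<^sub>m eval_axh n (hessian_x p) A X H)"
      by (intro psd_smult assms(7) that) simp
    moreover have "(1 / 2) \<cdot>\<^sub>m eval_axh n (hessian_x p) A X H = eval_ax n (x2_part p) A H"
      unfolding eval_hessian_x_quadratic[OF deg] by (intro eq_matI) simp_all
    ultimately show ?thesis by simp
  qed
  have convex: "globally_convex n (\<lambda>X. eval_ax n p A X)" if "n > 0" "A \<in> proj_a n (W n)" for n A
    using that(2) globally_convex_quadratic[OF deg] pos[OF that(1)] unfolding proj_a_def by blast
  have product: "(\<exists>q. q \<noteq> 0 \<and> degree_a q \<le> d_a \<and> degree_x q \<le> d_x - 2 \<and> vanishes_on q W) \<or>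
      (\<exists>\<Lambda> L. (\<forall>f\<in>set \<Lambda>. linear_in_x f) \<and> degree_x L \<le> 1 \<and> p = L + column_square \<Lambda>)"
    if V: "matrix_convex V" and WV: "\<forall>n>0. W n = sym_tuples n \<times> V n" for V :: "nat \<Rightarrow> 'g mtuple set"
  proof (cases "\<exists>m>0. V m \<noteq> {}")
    case True
    then have ne: "V n \<noteq> {}" if "n > 0" for n using matrix_convex_nonempty[OF V] that by blast
    have sym2: "nc_symmetric (x2_part p)"
      unfolding nc_symmetric_def
    proof (rule poly_mapping_eqI)
      fix w
      show "Poly_Mapping.lookup (nc_transpose (x2_part p)) w = Poly_Mapping.lookup (x2_part p) w"
        by (simp add: lookup_nc_transpose lookup_x2_part lookup_rev[OF assms(1)] flip: rev_filter)
    qed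
    have "\<exists>\<Lambda>. (\<forall>r\<in>set \<Lambda>. linear_in_x r) \<and> x2_part p = column_square \<Lambda>"
    proof (rule sum_of_squares_quadratic[OF sym2])
      fix n and A H :: "'g mtuple"
      assume n: "n > 0" and A: "A \<in> sym_tuples n" and H: "H \<in> sym_tuples n"
      obtain X where "X \<in> V n" using ne[OF n] by blast
      then have "(A, X) \<in> W n" using WV n A by simp
      then show "psd n (eval_ax n (x2_part p) A H)" using n H by (intro pos)
    qed (simp add: keys_x2_part)
    then obtain \<Lambda> where \<Lambda>: "\<forall>r\<in>set \<Lambda>. linear_in_x r" "x2_part p = column_square \<Lambda>" by blast
    have "degree_x (p - x2_part p) \<le> 1"
      unfolding degree_in_le
    proof
      fix w assume "w \<in> Poly_Mapping.keys (p - x2_part p)"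
      then have "w \<in> Poly_Mapping.keys p" "length (filter is_Xvar w) \<noteq> 2"
        by (auto simp: in_keys_iff lookup_minus lookup_x2_part split: if_splits)
      moreover from this(1) have "length (filter is_Xvar w) \<le> 2" using deg unfolding degree_in_le by blast
      ultimately show "length (filter is_Xvar w) \<le> 1" by linarith
    qed
    moreover have "p = (p - x2_part p) + column_square \<Lambda>" using \<Lambda>(2) by simp
    ultimately show ?thesis using \<Lambda>(1) by blast
  next
    case False
    \<comment> \<open>On an empty domain the constant polynomial \<open>1\<close> vanishes.\<close>
    then have "V n = {}" if "n > 0" for n using that by blast
    then have "W n = {}" if "n > 0" for n using WV that by simp
    then have "vanishes_on 1 W" by (simp add: vanishes_on_def)
    moreover have "degree_a 1 \<le> d_a" "degree_x 1 \<le> d_x - 2"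
      by (auto simp: degree_in_le in_keys_iff lookup_one zero_list_def when_def split: if_splits)
    ultimately show ?thesis by (intro disjI1 exI[of _ 1]) simp
  qed
  show ?thesis
  proof (intro conjI allI impI)
    show "(\<exists>q. q \<noteq> 0 \<and> degree_a q \<le> d_a \<and> degree_x q \<le> d_x - 2 \<and> vanishes_on q W) \<or>
        (degree_x p \<le> 2 \<and> (\<forall>n>0. \<forall>A\<in>proj_a n (W n). globally_convex n (\<lambda>X. eval_ax n p A X)))"
      using deg convex by (intro disjI2 conjI allI impI ballI)
  next
    fix V :: "nat \<Rightarrow> 'g mtuple set"
    assume "matrix_convex V \<and> (\<forall>n>0. W n = sym_tuples n \<times> V n)"
    then show "(\<exists>q. q \<noteq> 0 \<and> degree_a q \<le> d_a \<and> degree_x q \<le> d_x - 2 \<and> vanishes_on q W) \<or>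
        (\<exists>\<Lambda> L. (\<forall>f\<in>set \<Lambda>. linear_in_x f) \<and> degree_x L \<le> 1 \<and> p = L + column_square \<Lambda>)"
      by (elim conjE) (rule product)
  qed
qed

end
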